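(* Let $n\ge 2$ and $\mathfrak g=\mathfrak{gl}_n$ with Weyl group $W=S_n$. Let $\mathscr M$ be the set of $n\times n$ matrices with entries in $\mathbb R_{\ge 0}$, let $\mathscr M^{low}=\{M=(m_{ij})\in\mathscr M: m_{ij}=0\text{ for } i<j\}$, let $\overline C=\{\lambda\in\mathfrak h^*_{\mathbb R}:\langle\lambda,h_i\rangle\ge 0\ (i\in I)\}$ be the closure of the Weyl chamber, and let $\kappa:\mathscr M\to\bigsqcup_{\lambda\in\overline C}\mathscr B(\lambda)\times\mathscr B(\lambda)$ be the isomorphism of continuous $(\mathfrak{gl}_n,\mathfrak{gl}_n)$-bicrystals such that $\kappa(M_\lambda)=(\pi_\lambda,\pi_\lambda)$ for $\lambda=\sum_{i=1}^n\lambda_i\epsilon_i\in\overline C$, where $M_\lambda=\mathrm{diag}(\lambda_1,\dots,\lambda_n)$ (see the context). Then $\kappa$, when restricted to $\mathscr M^{low}$, gives a bijection $$\kappa:\ \mathscr M^{low}\longrightarrow\bigsqcup_{\lambda\in\overline C}\ \bigsqcup_{w\in W/W_\lambda}\mathscr B^w(\lambda)\times\widehat{\mathscr B}_w(\lambda).$$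
   Context: Weights. $I=\{1,\dots,n-1\}$, $\mathfrak h^*_{\mathbb R}=\bigoplus_{i=1}^n\mathbb R\epsilon_i$, $\alpha_i=\epsilon_i-\epsilon_{i+1}$, $\langle\epsilon_k,h_i\rangle=\delta_{k,i}-\delta_{k,i+1}$. Positive roots are $\beta=\epsilon_a-\epsilon_b$ ($a<b$), with coroot $h_\beta$, $\langle\epsilon_k,h_\beta\rangle=\delta_{k,a}-\delta_{k,b}$, and reflection $s_\beta$. $W=S_n$ permutes the $\epsilon_i$; $W_\lambda=\{w\in W:w\lambda=\lambda\}$. Paths. $\mathscr C$ is the set of continuous maps $\pi:[0,1]\to\mathfrak h^*_{\mathbb R}$. For $\pi\in\mathscr C$, $i\in I$, put $m_i=\inf_{t\in[0,1]}\langle\pi(t),h_i\rangle$, $\mathrm{wt}(\pi)=\pi(1)$, $\varepsilon_i(\pi)=-m_i$, $\varphi_i(\pi)=\langle\pi(1),h_i\rangle+\varepsilon_i(\pi)$. For $r\in\mathbb R$, $\tilde e_i^r\pi\in\mathscr C\cup\{\mathbf 0\}$ ($\mathbf 0$ a formal symbol) is $(\tilde e_i^r\pi)(t)=\pi(t)-\min\{-r,\ \inf_{s\in[t,1]}\langle\pi(s),h_i\rangle-m_i\}\alpha_i$ if $-\langle\pi(1),h_i\rangle+m_i\le r\le 0$; $(\tilde e_i^r\pi)(t)=\pi(t)-\min\{0,\ -r-m_i+\inf_{s\in[0,t]}\langle\pi(s),h_i\rangle\}\alpha_i$ if $0\le r\le -m_i$; and $\tilde e_i^r\pi=\mathbf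 0$ otherwise. $\pi*\pi'$ denotes the concatenation of paths ($\pi$ followed by $\pi'$ translated by $\pi(1)$). For $\mu\in\mathfrak h_{\mathbb R}^*$, $\pi_\mu(t)=t\mu$. The sets $\mathscr B(\lambda)$, $\lambda\in\overline C$. For $\mu,\nu\in W\lambda$, $\nu\ge\mu$ means there are $\nu=\nu_0,\dots,\nu_s=\mu$ and positive roots $\beta_1,\dots,\beta_s$ with $\langle\nu_{k-1},h_{\beta_k}\rangle<0$ and $\nu_k=s_{\beta_k}(\nu_{k-1})$. $\mathscr B(\lambda)$ is the set of pairs of sequences $\nu_1>\cdots>\nu_s$ in $W\lambda$ and real numbers $0=a_0<a_1<\cdots<a_s=1$, regarded as piecewise linear paths $\pi(t)=\sum_{k=1}^{i-1}(a_k-a_{k-1})\nu_k+(t-a_{i-1})\nu_i$ for $a_{i-1}\le t\le a_i$. $\mathscr B(\lambda)\cup\{\mathbf 0\}$ is stable under the $\tilde e_i^r$, so $\mathscr B(\lambda)$ is a continuous crystal. Put $\iota(\pi)=\nu_1$, $\tau(\pi)=\nu_s$, and for $w\in W$, $\mathscr B^w(\lambda)=\{\pi\in\mathscr B(\lambda):\tau(\pi)\ge w\lambda\}$, $\widehat{\mathscr B}_w(\lambda)=\{\pi\in\mathscr B(\lambda):\iota(\pi)=w\lambda\}$. The bicrystal $\mathscr M$. For $M=(m_{ij})\in\mathscr M$ let $\pi_M=\pi_{M^{(1)}}*\cdots*\pi_{M^{(n)}}$ with $\pi_{M^{(j)}}=\pi_{m_{nj}\epsilon_n}*\pi_{m_{n-1,j}\epsilon_{n-1}}*\cdots*\pi_{m_{1j}\epsilon_1}$.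 For $i\in I$, $r\in\mathbb R$, $\tilde e_i^rM$ is the unique matrix in $\mathscr M$ such that $\tilde e_i^r\pi_M=\pi_{\tilde e_i^rM}$ if $\tilde e_i^r\pi_M\ne\mathbf 0$, and $\tilde e_i^rM=\mathbf 0$ if $\tilde e_i^r\pi_M=\mathbf 0$; $\mathrm{wt},\varepsilon_i,\varphi_i$ of $M$ are those of $\pi_M$. A second structure is $(\tilde e_i^r)^\sharp M=(\tilde e_i^rM^t)^t$ ($M^t$ the transpose), $\mathrm{wt}^\sharp(M)=\mathrm{wt}(M^t)$, $\varepsilon_i^\sharp(M)=\varepsilon_i(M^t)$, $\varphi_i^\sharp(M)=\varphi_i(M^t)$. The operators $\tilde e_i^r$ and $(\tilde e_j^s)^\sharp$ commute on $\mathscr M$. The map $\kappa$. It is an isomorphism of continuous bicrystals $\mathscr M\to\bigsqcup_{\lambda\in\overline C}\mathscr B(\lambda)\times\mathscr B(\lambda)$ with $\kappa(M_\lambda)=(\pi_\lambda,\pi_\lambda)$ for $\lambda\in\overline C$, where $\tilde e_i^r$ and $(\tilde e_i^r)^\sharp$ act on the first and second components of $\mathscr B(\lambda)\times\mathscr B(\lambda)$, respectively; its existence is a previous result that may be taken as given.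
   Formalization: Both disjoint unions run only over those λ in the closed chamber with all λ_i ≥ 0 (so that M_λ lies in the set of nonnegative matrices); for λ with a negative entry M_λ is not in it and, weights being nonnegative, no such κ onto the union over the whole chamber exists. *)

theory Defs
  imports "HOL-Analysis.Analysis" "HOL-Combinatorics.Permutations"
begin

text \<open>
  The index set \<open>{1, \<dots>, n}\<close> is a finite linearly ordered type \<open>'n\<close> with \<open>n = CARD('n)\<close>; the
  real weight space of \<open>gl_n\<close> is \<open>real^'n\<close>, with \<open>\<epsilon>_i = axis i 1\<close>.  An \<open>n \<times> n\<close> matrix is an element
  of \<open>real^'n^'n\<close>, the entry in row \<open>i\<close> and column \<open>j\<close> being \<open>M $ i $ j\<close>.
\<close>

text \<open>The sort of \<open>'n\<close> is \<open>{finite, linorder}\<close> throughout; the synonyms avoid the implicit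
  sort \<open>finite\<close> of the notation \<open>real^'n\<close>.\<close>

type_synonym 'n weight = "(real, 'n) vec"
type_synonym 'n matrix = "((real, 'n) vec, 'n) vec"

section \<open>Roots and the Weyl group\<close>

definition simple_index :: "'n::{finite,linorder} set" where
  "simple_index = {i. \<exists>j. i < j}"

definition nxt :: "'n::{finite,linorder} \<Rightarrow> 'n" where
  "nxt i = Min {j. i < j}"

definition root_of :: "'n \<Rightarrow> 'n \<Rightarrow> 'n::{finite,linorder} weight" where
  "root_of a b = axis a 1 - axis b 1"

definition coroot :: "'n \<Rightarrow> 'n \<Rightarrow> 'n::{finite,linorder} weight \<Rightarrow> real" where
  "coroot a b v = v $ a - v $ b"

definition \<alpha> :: "'n \<Rightarrow> 'n::{finite,linorder} weight" where
  "\<alpha> i = root_of i (nxt i)"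

definition pair_h :: "'n \<Rightarrow> 'n::{finite,linorder} weight \<Rightarrow> real" where
  "pair_h i v = coroot i (nxt i) v"

definition refl_root :: "'n \<Rightarrow> 'n \<Rightarrow> 'n weight \<Rightarrow> 'n::{finite,linorder} weight" where
  "refl_root a b v = v - coroot a b v *\<^sub>R root_of a b"

definition weyl :: "('n::{finite,linorder} \<Rightarrow> 'n) set" where
  "weyl = {w. w permutes UNIV}"

text \<open>The action determined by \<open>w \<epsilon>_i = \<epsilon>_(w i)\<close>; hence the inverse on coordinates.\<close>

definition act :: "('n \<Rightarrow> 'n) \<Rightarrow> 'n weight \<Rightarrow> 'n::{finite,linorder} weight" where
  "act w v = (\<chi> k. v $ (inv w k))"

definition orbit_of :: "'n::{finite,linorder} weight \<Rightarrow> ('n weight) set" where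
  "orbit_of l = (\<lambda>w. act w l) ` weyl"

definition stab :: "'n::{finite,linorder} weight \<Rightarrow> ('n \<Rightarrow> 'n) set" where
  "stab l = {w \<in> weyl. act w l = l}"

definition weyl_cosets :: "'n::{finite,linorder} weight \<Rightarrow> ('n \<Rightarrow> 'n) set set" where
  "weyl_cosets l = (\<lambda>w. (\<lambda>u. w \<circ> u) ` stab l) ` weyl"

definition Cbar :: "('n::{finite,linorder} weight) set" where
  "Cbar = {l. \<forall>i\<in>simple_index. 0 \<le> pair_h i l}"

section \<open>Paths and root operators\<close>

text \<open>Paths are functions on \<open>[0, 1]\<close>, made \<open>extensional\<close> so that equality of functions is
  equality on \<open>[0, 1]\<close>.\<close>

type_synonym 'n path = "real \<Rightarrow> 'n weight"

definition paths :: "'n::{finite,linorder} path set" where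
  "paths = {p \<in> extensional {0..1}. continuous_on {0..1} p}"

definition path_min :: "'n \<Rightarrow> 'n::{finite,linorder} path \<Rightarrow> real" where
  "path_min i p = (INF t\<in>{0..1}. pair_h i (p t))"

definition path_wt :: "'n::{finite,linorder} path \<Rightarrow> 'n weight" where
  "path_wt p = p 1"

definition path_eps :: "'n \<Rightarrow> 'n::{finite,linorder} path \<Rightarrow> real" where
  "path_eps i p = - path_min i p"

definition path_phi :: "'n \<Rightarrow> 'n::{finite,linorder} path \<Rightarrow> real" where
  "path_phi i p = pair_h i (p 1) + path_eps i p"

text \<open>\<open>None\<close> is the formal symbol \<open>\<zero>\<close>.\<close>

definition path_e :: "'n \<Rightarrow> real \<Rightarrow> 'n::{finite,linorder} path \<Rightarrow> 'n path option" where
  "path_e i r p =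
    (if - pair_h i (p 1) + path_min i p \<le> r \<and> r \<le> 0 then
       Some (\<lambda>t\<in>{0..1}. p t - min (- r) ((INF s\<in>{t..1}. pair_h i (p s)) - path_min i p) *\<^sub>R \<alpha> i)
     else if 0 \<le> r \<and> r \<le> - path_min i p then
       Some (\<lambda>t\<in>{0..1}. p t - min 0 (- r - path_min i p + (INF s\<in>{0..t}. pair_h i (p s))) *\<^sub>R \<alpha> i)
     else None)"

definition line_path :: "'n weight \<Rightarrow> 'n::{finite,linorder} path" where
  "line_path v = (\<lambda>t\<in>{0..1}. t *\<^sub>R v)"

text \<open>
  Concatenation \<open>p_1 * \<dots> * p_N\<close> of a list of paths, each starting at \<open>0\<close>, run through one after the
  other in equal times: for \<open>(k-1)/N \<le> t \<le> k/N\<close> the sum below is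
  \<open>p_1(1) + \<dots> + p_(k-1)(1) + p_k(N t - (k-1))\<close>.
\<close>

definition concat_paths :: "'n::{finite,linorder} path list \<Rightarrow> 'n path" where
  "concat_paths ps = (\<lambda>t\<in>{0..1}. \<Sum>k<length ps. (ps ! k) (max 0 (min 1 (real (length ps) * t - real k))))"

text \<open>
  Concatenation is meant up to reparametrization.  For an \<open>N\<close>-fold concatenation each of the \<open>N\<close>
  factors is reparametrized separately, i.e. the junction times \<open>j/N\<close> stay fixed.
\<close>

definition reparam :: "nat \<Rightarrow> (real \<Rightarrow> real) set" where
  "reparam N = {f. continuous_on {0..1} f \<and> mono_on {0..1} f \<and>
     (\<forall>j\<le>N. f (real j / real N) = real j / real N)}"

definition same_upto_reparam :: "nat \<Rightarrow> 'n::{finite,linorder} path \<Rightarrow> 'n path \<Rightarrow> bool" where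
  "same_upto_reparam N p q \<longleftrightarrow>
    (\<exists>c\<in>paths. \<exists>f\<in>reparam N. \<exists>g\<in>reparam N. \<forall>t\<in>{0..1}. p t = c (f t) \<and> q t = c (g t))"

section \<open>Continuous crystals and their isomorphisms\<close>

record ('b, 'n::finite) crystal =
  elts :: "'b set"
  wt :: "'b \<Rightarrow> 'n weight"
  eps :: "'n \<Rightarrow> 'b \<Rightarrow> real"
  phi :: "'n \<Rightarrow> 'b \<Rightarrow> real"
  cop :: "'n \<Rightarrow> real \<Rightarrow> 'b \<Rightarrow> 'b option"

definition crystal_iso ::
  "('b, 'n::{finite,linorder}) crystal \<Rightarrow> ('c, 'n) crystal \<Rightarrow> ('b \<Rightarrow> 'c) \<Rightarrow> bool" where
  "crystal_iso K L f \<longleftrightarrow>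
     bij_betw f (elts K) (elts L) \<and>
     (\<forall>b\<in>elts K. wt L (f b) = wt K b) \<and>
     (\<forall>b\<in>elts K. \<forall>i\<in>simple_index. eps L i (f b) = eps K i b \<and> phi L i (f b) = phi K i b) \<and>
     (\<forall>b\<in>elts K. \<forall>i\<in>simple_index. \<forall>r. cop L i r (f b) = map_option f (cop K i r b))"

section \<open>The crystals \<open>B(\<lambda>)\<close>\<close>

definition orbit_step :: "'n::{finite,linorder} weight \<Rightarrow> 'n weight \<Rightarrow> bool" where
  "orbit_step \<nu> \<mu> \<longleftrightarrow> (\<exists>a b. a < b \<and> coroot a b \<nu> < 0 \<and> \<mu> = refl_root a b \<nu>)"

definition orbit_ge :: "'n::{finite,linorder} weight \<Rightarrow> 'n weight \<Rightarrow> bool" where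
  "orbit_ge \<nu> \<mu> \<longleftrightarrow> orbit_step\<^sup>*\<^sup>* \<nu> \<mu>"

definition orbit_gt :: "'n::{finite,linorder} weight \<Rightarrow> 'n weight \<Rightarrow> bool" where
  "orbit_gt \<nu> \<mu> \<longleftrightarrow> orbit_ge \<nu> \<mu> \<and> \<nu> \<noteq> \<mu>"

definition LS_data :: "'n::{finite,linorder} weight \<Rightarrow> ('n weight) list \<Rightarrow> real list \<Rightarrow> bool" where
  "LS_data l \<nu>s as \<longleftrightarrow>
     \<nu>s \<noteq> [] \<and> set \<nu>s \<subseteq> orbit_of l \<and> sorted_wrt orbit_gt \<nu>s \<and>
     length as = Suc (length \<nu>s) \<and> sorted_wrt (<) as \<and> hd as = 0 \<and> last as = 1"

text \<open>Lists are numbered from \<open>0\<close>: \<open>\<nu>s ! k\<close> is \<open>\<nu>_(k+1)\<close>, whereas \<open>as ! k\<close> is \<open>a_k\<close>.\<close>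

definition LS_traces :: "('n weight) list \<Rightarrow> real list \<Rightarrow> 'n::{finite,linorder} path \<Rightarrow> bool" where
  "LS_traces \<nu>s as p \<longleftrightarrow>
     p \<in> extensional {0..1} \<and>
     (\<forall>i<length \<nu>s. \<forall>t\<in>{as ! i..as ! Suc i}.
        p t = (\<Sum>k<i. (as ! Suc k - as ! k) *\<^sub>R (\<nu>s ! k)) + (t - as ! i) *\<^sub>R (\<nu>s ! i))"

definition LS_paths :: "'n weight \<Rightarrow> 'n::{finite,linorder} path set" where
  "LS_paths l = {p. \<exists>\<nu>s as. LS_data l \<nu>s as \<and> LS_traces \<nu>s as p}"

definition LS_init :: "'n weight \<Rightarrow> 'n::{finite,linorder} path \<Rightarrow> 'n weight" where
  "LS_init l p = (THE \<nu>. \<exists>\<nu>s as. LS_data l \<nu>s as \<and> LS_traces \<nu>s as p \<and> \<nu> = hd \<nu>s)"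

definition LS_final :: "'n weight \<Rightarrow> 'n::{finite,linorder} path \<Rightarrow> 'n weight" where
  "LS_final l p = (THE \<nu>. \<exists>\<nu>s as. LS_data l \<nu>s as \<and> LS_traces \<nu>s as p \<and> \<nu> = last \<nu>s)"

definition B_upper :: "'n weight \<Rightarrow> ('n \<Rightarrow> 'n) \<Rightarrow> 'n::{finite,linorder} path set" where
  "B_upper l w = {p \<in> LS_paths l. orbit_ge (LS_final l p) (act w l)}"

definition B_hat :: "'n weight \<Rightarrow> ('n \<Rightarrow> 'n) \<Rightarrow> 'n::{finite,linorder} path set" where
  "B_hat l w = {p \<in> LS_paths l. LS_init l p = act w l}"

text \<open>The product \<open>B_upper \<times> B_hat\<close> for a coset \<open>c = w W_\<lambda>\<close>: both factors depend on \<open>w\<close> only through \<open>w\<lambda>\<close>,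
  so all the sets in the union coincide.\<close>

definition coset_piece ::
  "'n weight \<Rightarrow> ('n \<Rightarrow> 'n) set \<Rightarrow> ('n::{finite,linorder} path \<times> 'n path) set" where
  "coset_piece l c = (\<Union>w\<in>c. B_upper l w \<times> B_hat l w)"

section \<open>The bicrystal of nonnegative matrices\<close>

definition Mats :: "('n::{finite,linorder} matrix) set" where
  "Mats = {M. \<forall>i j. 0 \<le> M $ i $ j}"

definition Mats_low :: "('n::{finite,linorder} matrix) set" where
  "Mats_low = {M \<in> Mats. \<forall>i j. i < j \<longrightarrow> M $ i $ j = 0}"

definition diag_mat :: "'n weight \<Rightarrow> 'n::{finite,linorder} matrix" where
  "diag_mat l = (\<chi> i j. if i = j then l $ i else 0)"

definition col_path :: "'n::{finite,linorder} matrix \<Rightarrow> 'n \<Rightarrow> 'n path" where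
  "col_path M j =
     concat_paths (map (\<lambda>k. line_path (M $ k $ j *\<^sub>R axis k 1)) (rev (sorted_list_of_set UNIV)))"

definition mat_path :: "'n::{finite,linorder} matrix \<Rightarrow> 'n path" where
  "mat_path M = concat_paths (map (col_path M) (sorted_list_of_set UNIV))"

text \<open>
  \<open>mat_path M\<close> is the concatenation of its \<open>n\<close> columns, so equality with \<open>mat_path M'\<close> is up to
  reparametrization inside each column.  Moving a junction between two columns must not be allowed:
  a column \<open>(0, b)\<^sup>t\<close> followed by \<open>(c, d)\<^sup>t\<close> would then be confused with \<open>(0, b + d)\<^sup>t\<close> followed
  by \<open>(c, 0)\<^sup>t\<close>, and \<open>M'\<close> would not be unique.
\<close>

definition mat_e ::
  "'n \<Rightarrow> real \<Rightarrow> 'n::{finite,linorder} matrix \<Rightarrow> ('n matrix) option" where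
  "mat_e i r M =
     map_option (\<lambda>p. THE M'. M' \<in> Mats \<and> same_upto_reparam CARD('n) p (mat_path M'))
       (path_e i r (mat_path M))"

definition mat_crystal :: "('n::{finite,linorder} matrix, 'n) crystal" where
  "mat_crystal = \<lparr> elts = Mats,
     wt = (\<lambda>M. path_wt (mat_path M)),
     eps = (\<lambda>i M. path_eps i (mat_path M)),
     phi = (\<lambda>i M. path_phi i (mat_path M)),
     cop = mat_e \<rparr>"

definition mat_crystal_sharp :: "('n::{finite,linorder} matrix, 'n) crystal" where
  "mat_crystal_sharp = \<lparr> elts = Mats,
     wt = (\<lambda>M. wt mat_crystal (transpose M)),
     eps = (\<lambda>i M. eps mat_crystal i (transpose M)),
     phi = (\<lambda>i M. phi mat_crystal i (transpose M)),
     cop = (\<lambda>i r M. map_option transpose (mat_e i r (transpose M))) \<rparr>"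

section \<open>The target of \<open>\<kappa>\<close>\<close>

text \<open>
  The dominant weights \<open>\<lambda>\<close> with \<open>diag(\<lambda>)\<close> nonnegative.  Weights of nonnegative matrices are
  nonnegative, so only these \<open>\<lambda>\<close> can occur in the decomposition of \<open>Mats\<close>.
\<close>

definition Cbar_poly :: "('n::{finite,linorder} weight) set" where
  "Cbar_poly = {l \<in> Cbar. diag_mat l \<in> Mats}"

type_synonym 'n target = "('n weight) \<times> ('n path \<times> 'n path)"

definition pairs :: "'n::{finite,linorder} target set" where
  "pairs = (SIGMA l:Cbar_poly. LS_paths l \<times> LS_paths l)"

definition pairs_crystal_fst :: "('n::{finite,linorder} target, 'n) crystal" where
  "pairs_crystal_fst = \<lparr> elts = pairs,
     wt = (\<lambda>(l, p, q). path_wt p),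
     eps = (\<lambda>i (l, p, q). path_eps i p),
     phi = (\<lambda>i (l, p, q). path_phi i p),
     cop = (\<lambda>i r (l, p, q). map_option (\<lambda>p'. (l, p', q)) (path_e i r p)) \<rparr>"

definition pairs_crystal_snd :: "('n::{finite,linorder} target, 'n) crystal" where
  "pairs_crystal_snd = \<lparr> elts = pairs,
     wt = (\<lambda>(l, p, q). path_wt q),
     eps = (\<lambda>i (l, p, q). path_eps i q),
     phi = (\<lambda>i (l, p, q). path_phi i q),
     cop = (\<lambda>i r (l, p, q). map_option (\<lambda>q'. (l, p, q')) (path_e i r q)) \<rparr>"

definition bicrystal_iso :: "('n::{finite,linorder} matrix \<Rightarrow> 'n target) \<Rightarrow> bool" where
  "bicrystal_iso \<kappa> \<longleftrightarrow>
     crystal_iso mat_crystal pairs_crystal_fst \<kappa> \<and>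
     crystal_iso mat_crystal_sharp pairs_crystal_snd \<kappa>"

end

(*
  Write iota and tau for the initial and final directions.  The target consists of the (l, p, q)
  with tau(p) >= iota(q), so for kappa M = (l, p, q) the claim is that M is lower triangular iff
  tau(p) >= iota(q).  This is shown by induction on iota(p), raising p by the maximal operator e_i
  for some i with <iota(p), h_i> < 0.

  On directions, the maximal e_i replaces iota by min(iota, s_i iota), and it changes tau at most
  to s_i tau, and this only if phi_i = 0 and <tau, h_i> < 0.  On matrices it is computed by a queue.
  If M is lower triangular, the maximal e_i followed by its transposed version yields a lower
  triangular matrix again; if moreover phi_i(M) > 0, then the maximal e_i alone does so.
  Conversely, M is lower triangular if its image under the maximal e_i is, or if phi_i(M) = 0 and
  its image under the transposed maximal e_i is.  These facts match the monotonicity of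
  v |-> min(v, s_i v) and v |-> max(v, s_i v) on the orbit.

  The induction ends at p = pi_l, where M is upper triangular: there both sides of the equivalence
  say that M = diag(l) and q = pi_l.
*)
theory Submission
  imports Defs
begin

section \<open>The order on an orbit\<close>

text \<open>The obstacle is the entry in row \<open>i\<close> and column \<open>nxt i\<close>. Above
  the diagonal it is the only entry that the maximal e_i can make nonzero on a lower triangular
  matrix: it receives what the diagonal entry below it cannot spend on the queue. The transposed
  operator moves it left onto the diagonal. This entry is the matrix counterpart of the possible
  reflection of tau, and phi_i, the final length of the queue, controls both: if phi_i is positive,
  the entry stays zero and tau stays fixed. Only r = eps_i occurs. There the root operator subtracts
  a running minimum, and for the path of a matrix this minimum is computed column by column. That
  \<open>path_emax i p\<close> stays in \<open>LS_paths l\<close> is read off from \<kappa>: it is a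
  component of the image of an explicitly computed matrix. Likewise the two orders of applying e_i
  and its transposed version are compared through their common image.\<close>

lemma nxt_greater: "i < nxt i" if "i \<in> simple_index"
  using that Min_in[of "{j. i < j}"] by (auto simp: simple_index_def nxt_def)

lemma nxt_le: "nxt i \<le> k" if "i < k"
  using that by (auto simp: nxt_def)

lemma refl_root_nth:
  assumes "a \<noteq> b"
  shows "refl_root a b v $ k = (if k = a then v $ b else if k = b then v $ a else v $ k)"
  using assms by (auto simp: refl_root_def coroot_def root_of_def axis_def algebra_simps)

lemma \<alpha>_nth:
  assumes "i \<in> simple_index"
  shows "\<alpha> i $ k = (if k = i then 1 else if k = nxt i then -1 else 0)"
  using nxt_greater[OF assms] by (auto simp: \<alpha>_def root_of_def axis_def)

abbreviation simple_refl :: "'n::{finite,linorder} \<Rightarrow> 'n weight \<Rightarrow> 'n weight" where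
  "simple_refl i \<equiv> refl_root i (nxt i)"

lemma simple_refl_eq: "simple_refl i v = v - pair_h i v *\<^sub>R \<alpha> i"
  by (simp add: refl_root_def pair_h_def \<alpha>_def)

lemma pair_h_simple_refl:
  "i \<in> simple_index \<Longrightarrow> pair_h i (simple_refl i v) = - pair_h i v"
  using nxt_greater[of i] by (auto simp: pair_h_def coroot_def refl_root_nth)

lemma simple_refl_invol: "i \<in> simple_index \<Longrightarrow> simple_refl i (simple_refl i v) = v"
  using nxt_greater[of i] by (auto simp: vec_eq_iff refl_root_nth)

lemma simple_refl_fixed: "pair_h i v = 0 \<Longrightarrow> simple_refl i v = v"
  by (simp add: simple_refl_eq)

lemma orbit_step_simple_refl:
  "i \<in> simple_index \<Longrightarrow> pair_h i v < 0 \<Longrightarrow> orbit_step v (simple_refl i v)"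
  using nxt_greater[of i] by (auto simp: orbit_step_def pair_h_def)

text \<open>A simple reflection permutes the positive roots other than its own, so it carries the
  step for (\<open>a\<close>, \<open>b\<close>) to a step for (\<open>\<sigma> a\<close>,
  \<open>\<sigma> b\<close>).\<close>

lemma orbit_step_cong_simple_refl:
  assumes i: "i \<in> simple_index" and "orbit_step \<mu> \<rho>" and "\<rho> \<noteq> simple_refl i \<mu>"
  shows "orbit_step (simple_refl i \<mu>) (simple_refl i \<rho>)"
proof -
  obtain a b where ab: "a < b" "coroot a b \<mu> < 0" "\<rho> = refl_root a b \<mu>"
    using assms(2) by (auto simp: orbit_step_def)
  define \<sigma> where "\<sigma> k = (if k = i then nxt i else if k = nxt i then i else k)" for k
  have neq: "\<not> (a = i \<and> b = nxt i)"
    using ab assms(3) by auto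
  consider "a = i" "nxt i < b" | "a = nxt i" | "a \<noteq> i" "a \<noteq> nxt i" "b = i"
    | "a \<noteq> i" "a < i" "b = nxt i" | "a \<noteq> i" "a \<noteq> nxt i" "b \<noteq> i" "b \<noteq> nxt i"
    using ab(1) neq nxt_le[of i b] nxt_le[of i a] by fastforce
  then have "\<sigma> a < \<sigma> b"
    using ab(1) nxt_greater[OF i] by cases (auto simp: \<sigma>_def)
  moreover have "coroot (\<sigma> a) (\<sigma> b) (simple_refl i \<mu>) = coroot a b \<mu>"
    using nxt_greater[OF i] by (auto simp: coroot_def refl_root_nth \<sigma>_def)
  moreover have "simple_refl i \<rho> = refl_root (\<sigma> a) (\<sigma> b) (simple_refl i \<mu>)"
    using nxt_greater[OF i] ab(1) calculation(1) unfolding ab(3)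
    by (auto simp: vec_eq_iff refl_root_nth \<sigma>_def)
  ultimately show ?thesis
    using ab(2) unfolding orbit_step_def by metis
qed

text \<open>\<open>lo\<close> and \<open>hi\<close> are the minimum and the maximum of {v, s_i v}:
  in this order dominant weights are lowest, and a negative pairing marks the upper element of the
  pair.\<close>

definition lo :: "'n::{finite,linorder} \<Rightarrow> 'n weight \<Rightarrow> 'n weight" where
  "lo i v = (if pair_h i v < 0 then simple_refl i v else v)"

definition hi :: "'n::{finite,linorder} \<Rightarrow> 'n weight \<Rightarrow> 'n weight" where
  "hi i v = (if 0 < pair_h i v then simple_refl i v else v)"

lemma orbit_ge_refl [simp]: "orbit_ge v v"
  by (simp add: orbit_ge_def)

lemma orbit_ge_trans [trans]: "orbit_ge u v \<Longrightarrow> orbit_ge v w \<Longrightarrow> orbit_ge u w"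
  by (simp add: orbit_ge_def)

lemma orbit_ge_step: "orbit_step u v \<Longrightarrow> orbit_ge u v"
  by (simp add: orbit_ge_def)

lemma orbit_ge_simple_refl:
  "i \<in> simple_index \<Longrightarrow> pair_h i v \<le> 0 \<Longrightarrow> orbit_ge v (simple_refl i v)"
  by (metis less_eq_real_def orbit_ge_refl orbit_ge_step orbit_step_simple_refl simple_refl_fixed)

lemma simple_refl_orbit_ge:
  "i \<in> simple_index \<Longrightarrow> 0 \<le> pair_h i v \<Longrightarrow> orbit_ge (simple_refl i v) v"
  using orbit_ge_simple_refl[of i "simple_refl i v"]
  by (simp add: pair_h_simple_refl simple_refl_invol)

lemma orbit_ge_lo: "i \<in> simple_index \<Longrightarrow> orbit_ge v (lo i v)"
  by (simp add: lo_def orbit_ge_simple_refl)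

lemma hi_orbit_ge: "i \<in> simple_index \<Longrightarrow> orbit_ge (hi i v) v"
  by (simp add: hi_def simple_refl_orbit_ge)

lemma hi_lo: "i \<in> simple_index \<Longrightarrow> hi i (lo i v) = hi i v"
  by (auto simp: hi_def lo_def pair_h_simple_refl simple_refl_invol)

lemma lo_simple_refl: "i \<in> simple_index \<Longrightarrow> lo i (simple_refl i v) = lo i v"
  by (cases "pair_h i v = 0")
     (auto simp: lo_def pair_h_simple_refl simple_refl_invol simple_refl_fixed)

lemma hi_simple_refl: "i \<in> simple_index \<Longrightarrow> hi i (simple_refl i v) = hi i v"
  by (cases "pair_h i v = 0")
     (auto simp: hi_def pair_h_simple_refl simple_refl_invol simple_refl_fixed)

text \<open>The lifting property of Bruhat order, checked on one step from \<rho> to \<sigma>. A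
  step by s_i itself leaves \<open>lo i\<close> unchanged. Any other step is reflected by s_i if
  \<rho> is the upper element of its pair, and used as it stands otherwise; its end then at most has
  to descend further.\<close>

lemma lo_mono:
  assumes i: "i \<in> simple_index" and "orbit_ge \<mu> \<rho>"
  shows "orbit_ge (lo i \<mu>) (lo i \<rho>)"
  using assms(2) unfolding orbit_ge_def
proof (induction rule: rtranclp_induct)
  case (step \<rho> \<sigma>)
  have "orbit_ge (lo i \<rho>) (lo i \<sigma>)"
  proof (cases "\<sigma> = simple_refl i \<rho>")
    case False
    then have s: "orbit_step (simple_refl i \<rho>) (simple_refl i \<sigma>)"
      using orbit_step_cong_simple_refl[OF i step(2)] by simp
    show ?thesis
    proof (cases "pair_h i \<rho> < 0")
      case True
      then show ?thesis
        using s orbit_ge_trans[OF orbit_ge_step[OF s] simple_refl_orbit_ge[OF i]]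
        by (auto simp: lo_def orbit_ge_step[OF s] simple_refl_invol[OF i])
    next
      case False
      then show ?thesis
        using orbit_ge_trans[OF orbit_ge_step[OF step(2)] orbit_ge_lo[OF i]]
        by (simp add: lo_def)
    qed
  qed (simp add: lo_simple_refl i)
  then show ?case
    using step.IH by (simp add: orbit_ge_def)
qed simp

text \<open>Dual to \<open>lo_mono\<close>, with the case split on the end of the step: the step is
  reflected only if \<sigma> is the lower element of its pair.\<close>

lemma hi_mono:
  assumes i: "i \<in> simple_index" and "orbit_ge \<mu> \<rho>"
  shows "orbit_ge (hi i \<mu>) (hi i \<rho>)"
  using assms(2) unfolding orbit_ge_def
proof (induction rule: rtranclp_induct)
  case (step \<rho> \<sigma>)
  have "orbit_ge (hi i \<rho>) (hi i \<sigma>)"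
  proof (cases "\<sigma> = simple_refl i \<rho>")
    case False
    then have s: "orbit_step (simple_refl i \<rho>) (simple_refl i \<sigma>)"
      using orbit_step_cong_simple_refl[OF i step(2)] by simp
    show ?thesis
    proof (cases "0 < pair_h i \<sigma>")
      case True
      then show ?thesis
        using orbit_ge_trans[OF orbit_ge_simple_refl[OF i] orbit_ge_step[OF s]]
        by (auto simp: hi_def orbit_ge_step[OF s])
    next
      case False
      then show ?thesis
        using orbit_ge_trans[OF hi_orbit_ge[OF i] orbit_ge_step[OF step(2)]]
        by (simp add: hi_def)
    qed
  qed (simp add: hi_simple_refl i)
  then show ?case
    using step.IH by (simp add: orbit_ge_def)
qed simp

section \<open>A rank on the orbit that decreases under simple reflections\<close>

lemma simple_refl_in_orbit:
  fixes v :: "'n::{finite,linorder} weight"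
  assumes "v \<in> orbit_of l" "i \<in> simple_index"
  shows "simple_refl i v \<in> orbit_of l"
proof -
  obtain w where w: "w permutes UNIV" "v = act w l"
    using assms(1) by (auto simp: orbit_of_def weyl_def)
  let ?s = "Transposition.transpose i (nxt i)"
  have "(?s \<circ> w) permutes UNIV"
    by (intro permutes_compose w permutes_swap_id) auto
  moreover have "simple_refl i v = act (?s \<circ> w) l"
    using nxt_greater[OF assms(2)] w
    by (auto simp: vec_eq_iff refl_root_nth act_def o_inv_distrib permutes_bij
        Transposition.transpose_def)
  ultimately show ?thesis
    by (auto simp: orbit_of_def weyl_def)
qed

lemma finite_orbit_of: "finite (orbit_of l)"
  by (simp add: orbit_of_def weyl_def finite_permutations)

text \<open>The coefficient of coordinate \<open>k\<close> is its position counted from 0. Up to a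
  shift that is constant on orbits, this is the pairing with minus the half sum of the positive
  coroots.\<close>

definition height :: "'n::{finite,linorder} weight \<Rightarrow> real" where
  "height v = (\<Sum>k\<in>UNIV. real (card {..<k}) * v $ k)"

text \<open>Heights are real; counting the lower elements of the finite orbit gives a natural number
  on which the main induction can run.\<close>

definition orbit_rank :: "'n::{finite,linorder} weight \<Rightarrow> 'n weight \<Rightarrow> nat" where
  "orbit_rank l v = card {u \<in> orbit_of l. height u < height v}"

lemma height_simple_refl:
  assumes "i \<in> simple_index" "pair_h i v < 0"
  shows "height (simple_refl i v) < height v"
proof -
  have "card {..<i} < card {..<nxt i}"
    using nxt_greater[OF assms(1)] by (intro psubset_card_mono) auto
  then have "0 < (real (card {..<i}) - real (card {..<nxt i})) * pair_h i v"
    using assms(2) by (simp add: mult_neg_neg)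
  moreover have "height (simple_refl i v)
      = height v - pair_h i v * (\<Sum>k\<in>UNIV. real (card {..<k}) * \<alpha> i $ k)"
    by (simp add: simple_refl_eq height_def algebra_simps sum_subtractf sum_distrib_left)
  moreover have "(\<Sum>k\<in>UNIV. real (card {..<k}) * \<alpha> i $ k)
      = (\<Sum>k\<in>{i, nxt i}. real (card {..<k}) * \<alpha> i $ k)"
    by (rule sum.mono_neutral_right) (auto simp: \<alpha>_nth[OF assms(1)])
  moreover have "\<dots> = real (card {..<i}) - real (card {..<nxt i})"
    using nxt_greater[OF assms(1)] by (simp add: \<alpha>_nth[OF assms(1)])
  ultimately show ?thesis
    by (simp add: mult.commute)
qed

lemma orbit_rank_simple_refl:
  assumes "v \<in> orbit_of l" "i \<in> simple_index" "pair_h i v < 0"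
  shows "orbit_rank l (simple_refl i v) < orbit_rank l v"
  unfolding orbit_rank_def
  using height_simple_refl[OF assms(2,3)] simple_refl_in_orbit[OF assms(1,2)]
  by (intro psubset_card_mono) (auto simp: finite_orbit_of)

section \<open>Dominant weights\<close>

lemma nxt_exists:
  fixes a b :: "'n::{finite,linorder}"
  assumes "a < b"
  obtains c where "c \<in> simple_index" "nxt c = b" "a \<le> c"
proof -
  define c where "c = Max {..<b}"
  have "Max {..<b} \<in> {..<b}"
    using \<open>a < b\<close> by (intro Max_in) auto
  then have c: "c < b" "\<And>k. k < b \<Longrightarrow> k \<le> c"
    by (simp_all add: c_def)
  then have s: "c \<in> simple_index"
    by (auto simp: simple_index_def)
  have "\<not> nxt c < b"
    using c(2)[of "nxt c"] nxt_greater[OF s] by auto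
  then have "nxt c = b" using nxt_le[OF c(1)] by simp
  then show ?thesis using that s c(2)[OF assms] by blast
qed

lemma Cbar_antimono:
  fixes v :: "'n::{finite,linorder} weight"
  assumes "v \<in> Cbar" "a \<le> b"
  shows "v $ b \<le> v $ a"
  using assms(2)
proof (induction "card {..<b}" arbitrary: b rule: less_induct)
  case less
  show ?case
  proof (cases "a = b")
    case False
    then have "a < b" using less.prems by simp
    then obtain c where c: "c \<in> simple_index" "nxt c = b" "a \<le> c"
      by (rule nxt_exists)
    then have cb: "c < b" using nxt_greater by blast
    have "v $ b \<le> v $ c"
      using assms(1) c(1,2) by (auto simp: Cbar_def pair_h_def coroot_def)
    moreover have "card {..<c} < card {..<b}"
      using cb by (intro psubset_card_mono) auto
    then have "v $ c \<le> v $ a"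
      using less.hyps c(3) by simp
    ultimately show ?thesis by simp
  qed simp
qed

lemma Cbar_orbit_ge_eq:
  assumes "v \<in> Cbar" "orbit_ge v u"
  shows "u = v"
proof -
  have "\<not> orbit_step v u" for u
    using Cbar_antimono[OF assms(1)]
    by (auto simp: orbit_step_def coroot_def not_less intro: order_less_imp_le)
  then show ?thesis
    using assms(2) unfolding orbit_ge_def by (metis converse_rtranclpE)
qed

lemma decreasing_rearrangement_unique:
  fixes v :: "'n::{finite,linorder} weight"
  assumes "v \<in> Cbar" "u \<in> Cbar" "u \<in> orbit_of v"
  shows "u = v"
proof -
  obtain w where w: "w permutes UNIV" "u = act w v"
    using assms(3) by (auto simp: orbit_of_def weyl_def)
  let ?xs = "sorted_list_of_set (UNIV :: 'n set)"
  \<comment> \<open>Signs are changed because \<open>sorted\<close> means increasing, whereas the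
    coordinates of a dominant weight decrease.\<close>
  have dec: "sorted (map (\<lambda>k. - x $ k) ?xs)" if "x \<in> Cbar" for x :: "'n weight"
    unfolding sorted_map
    by (rule sorted_wrt_mono_rel[OF _ sorted_sorted_list_of_set])
       (simp add: Cbar_antimono[OF that])
  have 1: "mset (map (\<lambda>k. - x $ k) ?xs) = image_mset (\<lambda>k. - x $ k) (mset_set UNIV)"
    for x :: "'n weight"
    using mset_set_set[of ?xs] by simp
  have 2: "image_mset (inv w) (mset_set UNIV) = mset_set UNIV"
    using permutes_inv[OF w(1)] image_mset_mset_set[of "inv w" UNIV]
    by (simp add: permutes_inj permutes_surj)
  have "image_mset (\<lambda>k. - u $ k) (mset_set UNIV)
      = image_mset (\<lambda>k. - v $ k) (image_mset (inv w) (mset_set UNIV))"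
    by (simp add: w(2) act_def image_mset.compositionality o_def)
  then have "mset (map (\<lambda>k. - u $ k) ?xs) = mset (map (\<lambda>k. - v $ k) ?xs)"
    unfolding 1 2 .
  then have "sort (map (\<lambda>k. - v $ k) ?xs) = map (\<lambda>k. - u $ k) ?xs"
    using dec[OF assms(2)] by (rule properties_for_sort)
  then have "map (\<lambda>k. - u $ k) ?xs = map (\<lambda>k. - v $ k) ?xs"
    using dec[OF assms(1)] by (simp add: sorted_sort_id)
  then have "\<forall>k\<in>set ?xs. - u $ k = - v $ k"
    by (simp only: map_eq_conv)
  then show ?thesis
    by (simp add: vec_eq_iff)
qed

section \<open>The maximal raising operator on paths\<close>

text \<open>At \<open>r = \<epsilon>_i(\<pi>)\<close> the root operator subtracts the running minimum.\<close>

definition path_emax :: "'n \<Rightarrow> 'n::{finite,linorder} path \<Rightarrow> 'n path" where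
  "path_emax i p = (\<lambda>t\<in>{0..1}. p t - (INF s\<in>{0..t}. pair_h i (p s)) *\<^sub>R \<alpha> i)"

lemma pair_h_simps [simp]:
  "pair_h i 0 = 0" "pair_h i (c *\<^sub>R v) = c * pair_h i v"
  "pair_h i (u + v) = pair_h i u + pair_h i v" "pair_h i (u - v) = pair_h i u - pair_h i v"
  by (simp_all add: pair_h_def coroot_def algebra_simps)

lemma continuous_on_pair_h [continuous_intros]:
  "continuous_on S p \<Longrightarrow> continuous_on S (\<lambda>t. pair_h i (p t))"
  by (simp add: pair_h_def coroot_def continuous_intros)

lemma continuous_INF_attained:
  fixes h :: "real \<Rightarrow> real"
  assumes "continuous_on {a..b} h" "a \<le> b"
  obtains s where "s \<in> {a..b}" "h s = (INF s\<in>{a..b}. h s)" "\<And>t. t \<in> {a..b} \<Longrightarrow> h s \<le> h t"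
proof -
  obtain s where s: "s \<in> {a..b}" "\<And>t. t \<in> {a..b} \<Longrightarrow> h s \<le> h t"
    using continuous_attains_inf[OF compact_Icc _ assms(1)] assms(2) by auto
  then have "(INF s\<in>{a..b}. h s) = h s"
    by (intro cInf_eq_minimum) auto
  then show ?thesis using that s by simp
qed

lemma INF_eq_minimum:
  fixes h :: "real \<Rightarrow> real"
  assumes "s \<in> S" "\<And>t. t \<in> S \<Longrightarrow> h s \<le> h t"
  shows "(INF s\<in>S. h s) = h s"
  using assms by (intro cInf_eq_minimum) auto

lemma path_e_path_eps:
  assumes cont: "continuous_on {0..1} p" and "p 0 = 0"
  shows "path_e i (path_eps i p) p = Some (path_emax i p)"
proof -
  let ?h = "\<lambda>t. pair_h i (p t)" and ?m = "path_min i p"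
  have ch: "continuous_on {0..1} ?h"
    by (intro continuous_intros cont)
  obtain s0 where "?h s0 = (INF s\<in>{0..1}. ?h s)" "\<And>t. t \<in> {0..1} \<Longrightarrow> ?h s0 \<le> ?h t"
    by (rule continuous_INF_attained[OF ch zero_le_one]) (rule that)
  then have le: "?m \<le> ?h t" if "t \<in> {0..1}" for t
    unfolding path_min_def using that by metis
  have "?m \<le> 0" using le[of 0] assms(2) by simp
  have run0: "(INF s\<in>{0..t}. ?h s) \<le> 0" if "t \<in> {0..1}" for t
  proof -
    have ct: "continuous_on {0..t} ?h" "0 \<le> t"
      using that by (auto intro: continuous_on_subset[OF ch])
    obtain s where "?h s = (INF s\<in>{0..t}. ?h s)" "\<And>u. u \<in> {0..t} \<Longrightarrow> ?h s \<le> ?h u"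
      by (rule continuous_INF_attained[OF ct]) (rule that)
    from this(1) this(2)[of 0] show ?thesis
      using that assms(2) by simp
  qed
  show ?thesis
  proof (cases "?m = 0")
    \<comment> \<open>Now \<open>r = 0\<close> already meets the first branch of
      \<open>path_e\<close>; this branch and \<open>path_emax\<close> both leave the path
      unchanged.\<close>
    case True
    have "(INF s\<in>{0..t}. ?h s) = 0" "0 \<le> (INF s\<in>{t..1}. ?h s)" if "t \<in> {0..1}" for t
    proof -
      have "(INF s\<in>{0..t}. ?h s) = ?h 0"
        using le True assms(2) that by (intro INF_eq_minimum) auto
      then show "(INF s\<in>{0..t}. ?h s) = 0" using assms(2) by simp
      show "0 \<le> (INF s\<in>{t..1}. ?h s)"
        using le True that by (intro cINF_greatest) auto
    qed
    then show ?thesis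
      using True le[of 1] by (auto simp: path_e_def path_eps_def path_emax_def fun_eq_iff)
  next
    case False
    then show ?thesis
      using \<open>?m \<le> 0\<close> run0
      by (auto simp: path_e_def path_eps_def path_emax_def fun_eq_iff min_def dest: antisym)
  qed
qed

section \<open>Initial and final directions\<close>

lemma LS_data_first: "LS_data l \<nu>s as \<Longrightarrow> as ! 0 = 0"
  by (cases as) (auto simp: LS_data_def)

lemma LS_data_last: "LS_data l \<nu>s as \<Longrightarrow> as ! length \<nu>s = 1"
  by (metis LS_data_def One_nat_def diff_Suc_1 last_conv_nth length_0_conv nat.simps(3))

lemma LS_data_less: "LS_data l \<nu>s as \<Longrightarrow> i < length \<nu>s \<Longrightarrow> as ! i < as ! Suc i"
  by (auto simp: LS_data_def sorted_wrt_nth_less)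

lemma LS_traces_initial:
  assumes "LS_data l \<nu>s as" "LS_traces \<nu>s as p"
  shows "\<exists>d>0. d \<le> 1 \<and> (\<forall>t\<in>{0..d}. p t = t *\<^sub>R hd \<nu>s)"
proof -
  have ne: "0 < length \<nu>s" using assms(1) by (simp add: LS_data_def)
  have "as ! Suc 0 \<le> 1"
    using assms(1) LS_data_last[OF assms(1)] ne sorted_wrt_nth_less[of "(<)" as "Suc 0" "length \<nu>s"]
    by (cases "length \<nu>s = Suc 0") (auto simp: LS_data_def Suc_lessI)
  then show ?thesis
    using LS_data_less[OF assms(1) ne] LS_data_first[OF assms(1)] assms(2) ne
    by (intro exI[of _ "as ! Suc 0"]) (auto simp: LS_traces_def hd_conv_nth dest!: spec[of _ 0])
qed

lemma LS_traces_final: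
  assumes "LS_data l \<nu>s as" "LS_traces \<nu>s as p"
  shows "\<exists>d>0. d \<le> 1 \<and> (\<forall>t\<in>{1 - d..1}. p t = p 1 - (1 - t) *\<^sub>R last \<nu>s)"
proof -
  define m where "m = length \<nu>s - 1"
  have ne: "\<nu>s \<noteq> []" and m: "m < length \<nu>s" "Suc m = length \<nu>s"
    using assms(1) by (auto simp: LS_data_def m_def)
  have one: "as ! Suc m = 1" using LS_data_last[OF assms(1)] m by simp
  have "0 \<le> as ! m"
    using assms(1) LS_data_first[OF assms(1)] m sorted_wrt_nth_less[of "(<)" as 0 m]
    by (cases "m = 0") (auto simp: LS_data_def)
  moreover have "as ! m < 1"
    using LS_data_less[OF assms(1) m(1)] one by simp
  moreover have "p t = p 1 - (1 - t) *\<^sub>R last \<nu>s" if "t \<in> {as ! m..1}" for t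
  proof -
    define S where "S = (\<Sum>k<m. (as ! Suc k - as ! k) *\<^sub>R (\<nu>s ! k))"
    have "p u = S + (u - as ! m) *\<^sub>R last \<nu>s" if "u \<in> {as ! m..1}" for u
      using assms(2) that m one ne
      by (auto simp: LS_traces_def S_def last_conv_nth m_def dest!: spec[of _ m])
    from this[OF that] this[of 1] that
    have "p t = S + (t - as ! m) *\<^sub>R last \<nu>s" "p 1 = S + (1 - as ! m) *\<^sub>R last \<nu>s"
      by simp_all
    then show ?thesis
      by (simp add: scaleR_diff_left)
  qed
  moreover have "{1 - (1 - as ! m)..1} = {as ! m..1}" by simp
  ultimately show ?thesis
    by (metis diff_ge_0_iff_ge diff_gt_0_iff_gt le_add_same_cancel1 diff_le_eq add.commute)
qed

lemma scaleR_germ_unique: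
  fixes u v :: "'a::real_vector"
  assumes "0 < d" "0 < e" "\<forall>t\<in>{0..d}. p t = t *\<^sub>R u" "\<forall>t\<in>{0..e}. p t = t *\<^sub>R v"
  shows "u = v"
proof -
  have "min d e *\<^sub>R u = min d e *\<^sub>R v"
    using assms by (metis atLeastAtMost_iff min.cobounded1 min.cobounded2 min_less_iff_conj order_less_imp_le)
  then show ?thesis using assms(1,2) by (simp add: min_def split: if_splits)
qed

text \<open>The germ of the path at 0 determines the first direction, whichever chain presents the
  path. This replaces the definite description in \<open>LS_init\<close> by a local
  property.\<close>

lemma LS_init_eq:
  assumes "p \<in> LS_paths l" "0 < d" "\<forall>t\<in>{0..d}. p t = t *\<^sub>R \<nu>"
  shows "LS_init l p = \<nu>"
proof -
  have "hd \<nu>s = \<nu>" if "LS_data l \<nu>s as" "LS_traces \<nu>s as p" for \<nu>s as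
    using LS_traces_initial[OF that] scaleR_germ_unique assms(2,3) by blast
  moreover obtain \<nu>s as where "LS_data l \<nu>s as" "LS_traces \<nu>s as p"
    using assms(1) by (auto simp: LS_paths_def)
  ultimately show ?thesis
    unfolding LS_init_def by (intro the_equality) metis+
qed

lemma LS_final_eq:
  assumes "p \<in> LS_paths l" "0 < d" "\<forall>t\<in>{1 - d..1}. p t = p 1 - (1 - t) *\<^sub>R \<nu>"
  shows "LS_final l p = \<nu>"
proof -
  \<comment> \<open>Reversing the path turns its germ at the endpoint into a germ at 0.\<close>
  let ?q = "\<lambda>t. p 1 - p (1 - t)"
  have *: "\<forall>t\<in>{0..e}. ?q t = t *\<^sub>R u" if "\<forall>t\<in>{1 - e..1}. p t = p 1 - (1 - t) *\<^sub>R u" for e u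
  proof
    fix t :: real assume "t \<in> {0..e}"
    then have "p (1 - t) = p 1 - (1 - (1 - t)) *\<^sub>R u"
      by (intro that[rule_format]) auto
    then show "?q t = t *\<^sub>R u" by simp
  qed
  have "last \<nu>s = \<nu>" if "LS_data l \<nu>s as" "LS_traces \<nu>s as p" for \<nu>s as
    using LS_traces_final[OF that] scaleR_germ_unique[of _ _ ?q] * assms(2,3) by metis
  moreover obtain \<nu>s as where "LS_data l \<nu>s as" "LS_traces \<nu>s as p"
    using assms(1) by (auto simp: LS_paths_def)
  ultimately show ?thesis
    unfolding LS_final_def by (intro the_equality) metis+
qed

lemma LS_initE:
  assumes "p \<in> LS_paths l"
  obtains d where "0 < d" "d \<le> 1" "\<forall>t\<in>{0..d}. p t = t *\<^sub>R LS_init l p"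
proof -
  obtain \<nu>s as where "LS_data l \<nu>s as" "LS_traces \<nu>s as p"
    using assms by (auto simp: LS_paths_def)
  then show ?thesis
    using LS_traces_initial LS_init_eq[OF assms] that by metis
qed

lemma LS_finalE:
  assumes "p \<in> LS_paths l"
  obtains d where "0 < d" "d \<le> 1" "\<forall>t\<in>{1 - d..1}. p t = p 1 - (1 - t) *\<^sub>R LS_final l p"
proof -
  obtain \<nu>s as where "LS_data l \<nu>s as" "LS_traces \<nu>s as p"
    using assms by (auto simp: LS_paths_def)
  then show ?thesis
    using LS_traces_final LS_final_eq[OF assms] that by metis
qed

lemma LS_init_eq_hd:
  assumes "LS_data l \<nu>s as" "LS_traces \<nu>s as p"
  shows "LS_init l p = hd \<nu>s"
  using LS_traces_initial[OF assms] LS_init_eq[of p l] assms by (auto simp: LS_paths_def)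

lemma LS_init_in_orbit: "p \<in> LS_paths l \<Longrightarrow> LS_init l p \<in> orbit_of l"
  by (auto simp: LS_paths_def LS_init_eq_hd) (auto simp: LS_data_def)

lemma LS_paths_start: "p \<in> LS_paths l \<Longrightarrow> p 0 = 0"
  by (erule LS_initE) simp

lemma LS_paths_continuous:
  assumes "p \<in> LS_paths l"
  shows "continuous_on {0..1} p"
proof -
  obtain \<nu>s as where d: "LS_data l \<nu>s as" and tr: "LS_traces \<nu>s as p"
    using assms by (auto simp: LS_paths_def)
  have "0 \<le> as ! i \<and> continuous_on {0..as ! i} p" if "i \<le> length \<nu>s" for i
    using that
  proof (induction i)
    case 0
    then show ?case by (simp add: LS_data_first[OF d])
  next
    case (Suc i)
    have "continuous_on {as ! i..as ! Suc i}
        (\<lambda>t. (\<Sum>k<i. (as ! Suc k - as ! k) *\<^sub>R (\<nu>s ! k)) + (t - as ! i) *\<^sub>R (\<nu>s ! i))"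
      by (intro continuous_intros)
    then have "continuous_on {as ! i..as ! Suc i} p"
      by (rule continuous_on_eq) (use tr Suc.prems in \<open>simp add: LS_traces_def Suc_le_eq\<close>)
    moreover have "{0..as ! Suc i} = {0..as ! i} \<union> {as ! i..as ! Suc i}"
      using Suc LS_data_less[OF d, of i] by auto
    ultimately show ?case
      using Suc LS_data_less[OF d, of i] by (auto intro!: continuous_on_closed_Un)
  qed
  from this[of "length \<nu>s"] show ?thesis
    by (simp add: LS_data_last[OF d])
qed

lemma line_path_in_LS_paths: "line_path l \<in> LS_paths l"
proof -
  have "l \<in> orbit_of l"
    by (auto simp: orbit_of_def weyl_def act_def intro!: image_eqI[of _ _ id] permutes_id)
  then have "LS_data l [l] [0, 1]" "LS_traces [l] [0, 1] (line_path l)"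
    by (auto simp: LS_data_def LS_traces_def line_path_def)
  then show ?thesis
    by (auto simp: LS_paths_def)
qed

lemma LS_init_line_path [simp]: "LS_init l (line_path l) = l"
  by (rule LS_init_eq[OF line_path_in_LS_paths zero_less_one]) (simp add: line_path_def)

lemma LS_final_line_path [simp]: "LS_final l (line_path l) = l"
  by (rule LS_final_eq[OF line_path_in_LS_paths zero_less_one])
     (simp add: line_path_def algebra_simps)

text \<open>The chain of directions descends strictly from its first member, and nothing lies
  strictly below a dominant weight, so the chain has length one.\<close>

lemma LS_init_dominant:
  assumes "l \<in> Cbar" "p \<in> LS_paths l" "LS_init l p = l"
  shows "p = line_path l"
proof -
  obtain \<nu>s as where d: "LS_data l \<nu>s as" and tr: "LS_traces \<nu>s as p"
    using assms(2) by (auto simp: LS_paths_def)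
  have "hd \<nu>s = l" using LS_init_eq_hd[OF d tr] assms(3) by simp
  then obtain \<mu>s where \<mu>s: "\<nu>s = l # \<mu>s"
    using d by (cases \<nu>s) (auto simp: LS_data_def)
  have "\<mu>s = []"
    using d Cbar_orbit_ge_eq[OF assms(1)] \<mu>s
    by (cases \<mu>s) (auto simp: LS_data_def orbit_gt_def)
  then have "as ! 0 = 0" "as ! Suc 0 = 1"
    using LS_data_first[OF d] LS_data_last[OF d] \<mu>s by simp_all
  then have "p t = t *\<^sub>R l" if "t \<in> {0..1}" for t
    using tr that \<mu>s \<open>\<mu>s = []\<close> by (simp add: LS_traces_def)
  moreover have "p \<in> extensional {0..1}"
    using tr by (simp add: LS_traces_def)
  ultimately show ?thesis
    by (auto simp: line_path_def extensional_def fun_eq_iff)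
qed

text \<open>Near 0 the pairing with h_i is linear in time. If its slope is negative, the running
  minimum is the current value and subtracting it reflects the direction; otherwise the running
  minimum is 0.\<close>

lemma LS_init_path_emax:
  assumes i: "i \<in> simple_index" and p: "p \<in> LS_paths l" and "path_emax i p \<in> LS_paths l"
  shows "LS_init l (path_emax i p) = lo i (LS_init l p)"
proof -
  let ?\<nu> = "LS_init l p"
  obtain d where d: "0 < d" "d \<le> 1" "\<forall>t\<in>{0..d}. p t = t *\<^sub>R ?\<nu>"
    using LS_initE[OF p] .
  have "path_emax i p t = t *\<^sub>R lo i ?\<nu>" if t: "t \<in> {0..d}" for t
  proof (cases "pair_h i ?\<nu> < 0")
    case True
    have "(INF s\<in>{0..t}. pair_h i (p s)) = pair_h i (p t)"
      using t d True by (intro INF_eq_minimum) (auto intro: mult_right_mono_neg)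
    then show ?thesis
      using t d True by (simp add: path_emax_def lo_def simple_refl_eq algebra_simps)
  next
    case False
    have "(INF s\<in>{0..t}. pair_h i (p s)) = pair_h i (p 0)"
      using t d False LS_paths_start[OF p] by (intro INF_eq_minimum) auto
    then show ?thesis
      using t d False LS_paths_start[OF p] by (simp add: path_emax_def lo_def)
  qed
  then show ?thesis
    using LS_init_eq[OF assms(3) d(1)] by blast
qed

text \<open>The final direction is reflected exactly if the minimum is attained at the endpoint only.\<close>

lemma LS_final_path_emax:
  assumes i: "i \<in> simple_index" and p: "p \<in> LS_paths l" and p': "path_emax i p \<in> LS_paths l"
  shows "LS_final l (path_emax i p) = LS_final l p \<or>
    LS_final l (path_emax i p) = simple_refl i (LS_final l p) \<and>
      path_phi i p = 0 \<and> pair_h i (LS_final l p) < 0"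
proof -
  let ?h = "\<lambda>t. pair_h i (p t)" and ?\<tau> = "LS_final l p"
  obtain d where d: "0 < d" "d \<le> 1" "\<forall>t\<in>{1 - d..1}. p t = p 1 - (1 - t) *\<^sub>R ?\<tau>"
    using LS_finalE[OF p] .
  have ch: "continuous_on {0..1} ?h"
    using LS_paths_continuous[OF p] by (intro continuous_intros)
  obtain t0 where t0: "t0 \<in> {0..1}" "?h t0 = path_min i p" "\<And>t. t \<in> {0..1} \<Longrightarrow> ?h t0 \<le> ?h t"
    using continuous_INF_attained[OF ch zero_le_one, folded path_min_def] by blast
  show ?thesis
  proof (cases "\<exists>t1\<in>{0..<1}. ?h t1 = ?h t0")
    case True
    then obtain t1 where t1: "t1 \<in> {0..<1}" "?h t1 = ?h t0" by auto
    \<comment> \<open>From \<open>t1\<close> on the running minimum is constant, so this last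
      stretch of the path is only translated.\<close>
    define e where "e = min d (1 - t1)"
    have run: "(INF s\<in>{0..t}. ?h s) = ?h t1" if "t \<in> {t1..1}" for t
      using t0 t1 that by (intro INF_eq_minimum) auto
    have "path_emax i p t = path_emax i p 1 - (1 - t) *\<^sub>R ?\<tau>" if "t \<in> {1 - e..1}" for t
    proof -
      have "t \<in> {t1..1}" "t \<in> {1 - d..1}" "t \<in> {0..1}"
        using that t1 by (auto simp: e_def)
      then show ?thesis
        using run[of t] run[of 1] t1 bspec[OF d(3), of t] by (simp add: path_emax_def)
    qed
    moreover have "0 < e" using d(1) t1 by (simp add: e_def)
    ultimately show ?thesis
      using LS_final_eq[OF p'] by blast
  next
    case False
    then have "\<not> t0 < 1" using t0(1) by auto
    then have "t0 = 1" using t0(1) by auto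
    have less: "?h 1 < ?h t" if "t \<in> {0..<1}" for t
    proof -
      have "?h t \<noteq> ?h 1" using False \<open>t0 = 1\<close> that by blast
      then show ?thesis using t0(3)[of t] \<open>t0 = 1\<close> that by auto
    qed
    have hd: "?h t = ?h 1 - (1 - t) * pair_h i ?\<tau>" if "t \<in> {1 - d..1}" for t
      using bspec[OF d(3) that] by simp
    have neg: "pair_h i ?\<tau> < 0"
      using less[of "1 - d"] hd[of "1 - d"] d(1,2) by (simp add: zero_less_mult_iff mult_less_0_iff)
    have cd: "continuous_on {0..1 - d} ?h" "0 \<le> 1 - d"
      using d(1,2) by (auto intro: continuous_on_subset[OF ch])
    obtain t1 where t1: "t1 \<in> {0..1 - d}" "\<And>t. t \<in> {0..1 - d} \<Longrightarrow> ?h t1 \<le> ?h t"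
      by (rule continuous_INF_attained[OF cd]) (rule that)
    \<comment> \<open>The quotient is the distance from time 1 at which the final linear piece of
      \<open>?h\<close> reaches \<open>?h t1\<close>. Closer to 1 than this, \<open>?h\<close> lies
      below all its earlier values, so the running minimum is the current value.\<close>
    define e where "e = min d ((?h t1 - ?h 1) / (- pair_h i ?\<tau>))"
    have "0 < e"
      using less[of t1] t1(1) d(1,2) neg by (auto simp: e_def divide_pos_neg)
    have run: "(INF s\<in>{0..t}. ?h s) = ?h t" if t: "t \<in> {1 - e..1}" for t
    proof (rule INF_eq_minimum)
      have td: "t \<in> {1 - d..1}" "1 - t \<le> (?h t1 - ?h 1) / (- pair_h i ?\<tau>)"
        using t by (auto simp: e_def)
      have "0 < - pair_h i ?\<tau>" using neg by simp
      then have "(1 - t) * (- pair_h i ?\<tau>) \<le> ?h t1 - ?h 1"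
        using td(2) by (simp only: pos_le_divide_eq)
      then have ht: "?h t \<le> ?h t1" using hd[OF td(1)] by simp
      show "t \<in> {0..t}" using td d(1,2) by auto
      fix s assume s: "s \<in> {0..t}"
      show "?h t \<le> ?h s"
      proof (cases "s \<le> 1 - d")
        case True
        then show ?thesis using t1(2)[of s] s ht by simp
      next
        case False
        then have "?h s = ?h 1 - (1 - s) * pair_h i ?\<tau>"
          using hd[of s] s td by simp
        moreover have "(1 - s) * pair_h i ?\<tau> \<le> (1 - t) * pair_h i ?\<tau>"
          using s neg by (intro mult_right_mono_neg) auto
        ultimately show ?thesis using hd[OF td(1)] by simp
      qed
    qed
    have "path_emax i p t = path_emax i p 1 - (1 - t) *\<^sub>R simple_refl i ?\<tau>" if "t \<in> {1 - e..1}" for t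
    proof -
      have "t \<in> {1 - d..1}" "t \<in> {0..1}"
        using that d(1,2) by (auto simp: e_def)
      then show ?thesis
        using bspec[OF d(3), of t] run[of t] run[of 1] hd[of t] that \<open>0 < e\<close>
        by (simp add: path_emax_def simple_refl_eq scaleR_diff_left scaleR_diff_right left_diff_distrib)
    qed
    then have "LS_final l (path_emax i p) = simple_refl i ?\<tau>"
      using LS_final_eq[OF p' \<open>0 < e\<close>] by blast
    moreover have "path_phi i p = 0"
      using t0(2) \<open>t0 = 1\<close> by (simp add: path_phi_def path_eps_def)
    ultimately show ?thesis using neg by simp
  qed
qed

text \<open>Just before its end the path rises with respect to h_i, so the minimum lies strictly
  below the final value.\<close>

lemma path_phi_pos:
  assumes p: "p \<in> LS_paths l" and "0 < pair_h i (LS_final l p)"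
  shows "0 < path_phi i p"
proof -
  obtain d where d: "0 < d" "d \<le> 1" "\<forall>t\<in>{1 - d..1}. p t = p 1 - (1 - t) *\<^sub>R LS_final l p"
    using LS_finalE[OF p] .
  have ch: "continuous_on {0..1} (\<lambda>t. pair_h i (p t))"
    using LS_paths_continuous[OF p] by (intro continuous_intros)
  obtain s where "pair_h i (p s) = path_min i p"
      "\<And>t. t \<in> {0..1} \<Longrightarrow> pair_h i (p s) \<le> pair_h i (p t)"
    using continuous_INF_attained[OF ch zero_le_one, folded path_min_def] by blast
  then have "path_min i p \<le> pair_h i (p (1 - d))"
    using d(1,2) by (metis atLeastAtMost_iff diff_ge_0_iff_ge diff_le_self less_imp_le le_add_same_cancel1 diff_le_eq)
  also have "\<dots> < pair_h i (p 1)"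
    using d(1,2) bspec[OF d(3), of "1 - d"] assms(2) by simp
  finally show ?thesis
    by (simp add: path_phi_def path_eps_def)
qed

section \<open>The path of a matrix\<close>

text \<open>The local time of one factor in \<open>concat_paths\<close>: 0 before its turn, 1 after
  it.\<close>

definition clamp01 :: "real \<Rightarrow> real" where
  "clamp01 x = max 0 (min 1 x)"

lemma clamp01_bounds [simp]: "0 \<le> clamp01 x" "clamp01 x \<le> 1"
  by (auto simp: clamp01_def)

lemma clamp01_eq: "x \<le> 0 \<Longrightarrow> clamp01 x = 0" "1 \<le> x \<Longrightarrow> clamp01 x = 1"
    "0 \<le> x \<Longrightarrow> x \<le> 1 \<Longrightarrow> clamp01 x = x"
  by (auto simp: clamp01_def)

lemma clamp01_mono: "x \<le> y \<Longrightarrow> clamp01 x \<le> clamp01 y"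
  by (auto simp: clamp01_def)

lemma continuous_on_clamp01 [continuous_intros]:
  "continuous_on S f \<Longrightarrow> continuous_on S (\<lambda>x. clamp01 (f x))"
  unfolding clamp01_def by (intro continuous_intros)

section \<open>Positions in the index set\<close>

definition enum_of :: "nat \<Rightarrow> 'n::{finite,linorder}" where
  "enum_of q = sorted_list_of_set UNIV ! q"

definition index_of :: "'n::{finite,linorder} \<Rightarrow> nat" where
  "index_of k = card {..<k}"

text \<open>The columns of a matrix are read from the bottom row upwards.\<close>

definition slot_of :: "'n::{finite,linorder} \<Rightarrow> nat" where
  "slot_of k = card {k<..}"

lemma length_sorted_UNIV [simp]:
  "length (sorted_list_of_set (UNIV :: 'n::{finite,linorder} set)) = CARD('n)"
  by simp

lemma index_of_less: "index_of (k :: 'n::{finite,linorder}) < CARD('n)"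
  unfolding index_of_def by (intro psubset_card_mono) auto

lemma index_of_strict_mono: "a < b \<Longrightarrow> index_of a < index_of b"
  unfolding index_of_def by (intro psubset_card_mono) auto

lemma index_of_less_iff [simp]: "index_of a < index_of b \<longleftrightarrow> a < b"
  using index_of_strict_mono[of a b] index_of_strict_mono[of b a]
  by (cases a b rule: linorder_cases) auto

lemma index_of_enum_of:
  assumes "q < CARD('n)"
  shows "index_of (enum_of q :: 'n::{finite,linorder}) = q"
proof -
  let ?xs = "sorted_list_of_set (UNIV :: 'n set)"
  have lt: "?xs ! a < ?xs ! b" if "a < b" "b < CARD('n)" for a b
    using that sorted_wrt_nth_less[OF strict_sorted_list_of_set, of a b UNIV] by simp
  have "{..<enum_of q :: 'n} = (!) ?xs ` {..<q}"
  proof (intro equalityI subsetI)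
    fix x :: 'n assume "x \<in> {..<enum_of q}"
    moreover obtain a where a: "a < CARD('n)" "x = ?xs ! a"
      by (metis UNIV_I finite_class.finite_UNIV in_set_conv_nth length_sorted_UNIV set_sorted_list_of_set)
    moreover have "a < q"
      using calculation lt[of q a] by (force simp: enum_of_def not_less dest: le_neq_implies_less)
    ultimately show "x \<in> (!) ?xs ` {..<q}" by auto
  next
    fix x :: 'n assume "x \<in> (!) ?xs ` {..<q}"
    then show "x \<in> {..<enum_of q}"
      using lt assms by (auto simp: enum_of_def)
  qed
  moreover have "inj_on ((!) ?xs) {..<q}"
    using assms by (intro inj_onI) (auto simp: nth_eq_iff_index_eq)
  ultimately show ?thesis
    by (simp add: index_of_def card_image)
qed

lemma bij_betw_index_of: "bij_betw (index_of :: 'n::{finite,linorder} \<Rightarrow> nat) UNIV {..<CARD('n)}"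
proof (rule bij_betwI')
  fix x y :: 'n
  show "index_of x = index_of y \<longleftrightarrow> x = y"
    by (metis index_of_less_iff less_irrefl linorder_less_linear)
  show "index_of x \<in> {..<CARD('n)}" by (simp add: index_of_less)
next
  fix q assume "q \<in> {..<CARD('n)}"
  then show "\<exists>x::'n\<in>UNIV. q = index_of x"
    using index_of_enum_of by (metis UNIV_I lessThan_iff)
qed

lemma enum_of_index_of [simp]: "enum_of (index_of k) = k"
  by (metis bij_betw_imp_inj_on bij_betw_index_of index_of_enum_of index_of_less inj_eq)

lemma enum_of_eq_iff: "q < CARD('n) \<Longrightarrow> enum_of q = (k :: 'n::{finite,linorder}) \<longleftrightarrow> q = index_of k"
  using index_of_enum_of by force

lemma sum_enum_of: "(\<Sum>q<CARD('n). f (enum_of q)) = (\<Sum>k\<in>(UNIV :: 'n::{finite,linorder} set). f k)"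
  using sum.reindex_bij_betw[OF bij_betw_index_of[where ?'n = 'n], of "\<lambda>q. f (enum_of q)"]
  by simp

lemma slot_of_plus_index_of: "slot_of (k :: 'n::{finite,linorder}) + index_of k + 1 = CARD('n)"
proof -
  have "(UNIV :: 'n set) = {k<..} \<union> ({..<k} \<union> {k})" by auto
  then have "CARD('n) = card ({k<..} \<union> ({..<k} \<union> {k}))" by metis
  also have "\<dots> = slot_of k + index_of k + 1"
    by (subst card_Un_disjoint; auto simp: slot_of_def index_of_def)
  finally show ?thesis by simp
qed

lemma slot_of_less: "slot_of (k :: 'n::{finite,linorder}) < CARD('n)"
  using slot_of_plus_index_of[of k] by simp

lemma slot_of_less_iff: "slot_of a < slot_of b \<longleftrightarrow> b < (a :: 'n::{finite,linorder})"
  using slot_of_plus_index_of[of a] slot_of_plus_index_of[of b] index_of_less_iff[of b a] by linarith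

lemma slot_of_nxt:
  assumes "i \<in> simple_index"
  shows "slot_of i = Suc (slot_of (nxt i))"
proof -
  have "{i<..} = insert (nxt i) {nxt i<..}"
    using nxt_greater[OF assms] nxt_le[of i] by (auto simp: le_less)
  then show ?thesis by (simp add: slot_of_def)
qed

section \<open>Coordinates of the path of a matrix\<close>

lemma col_path_nth:
  fixes M :: "'n::{finite,linorder} matrix" and s :: real
  assumes "s \<in> {0..1}"
  shows "col_path M j s $ k = M $ k $ j * clamp01 (real CARD('n) * s - real (slot_of k))"
proof -
  let ?n = "CARD('n)" and ?xs = "sorted_list_of_set (UNIV :: 'n set)"
  have rev: "rev ?xs ! m = enum_of (?n - Suc m)" if "m < ?n" for m
    using that by (simp add: rev_nth enum_of_def)
  have "col_path M j s $ k = (\<Sum>m<?n. line_path (M $ (rev ?xs ! m) $ j *\<^sub>R axis (rev ?xs ! m) 1)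
      (clamp01 (real ?n * s - real m)) $ k)"
    using assms by (simp add: col_path_def concat_paths_def clamp01_def)
  also have "\<dots> = (\<Sum>m<?n. if m = slot_of k then M $ k $ j * clamp01 (real ?n * s - real m) else 0)"
  proof (rule sum.cong[OF refl])
    fix m assume "m \<in> {..<?n}"
    moreover have "enum_of (?n - Suc m) = k \<longleftrightarrow> m = slot_of k" if "m < ?n"
      using that slot_of_plus_index_of[of k] by (subst enum_of_eq_iff) auto
    ultimately show "line_path (M $ (rev ?xs ! m) $ j *\<^sub>R axis (rev ?xs ! m) 1) (clamp01 (real ?n * s - real m)) $ k
        = (if m = slot_of k then M $ k $ j * clamp01 (real ?n * s - real m) else 0)"
      by (auto simp: line_path_def rev axis_def)
  qed
  also have "\<dots> = M $ k $ j * clamp01 (real ?n * s - real (slot_of k))"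
    using slot_of_less[of k] by (simp add: sum.delta')
  finally show ?thesis .
qed

lemma mat_path_nth:
  fixes M :: "'n::{finite,linorder} matrix" and t :: real
  assumes "t \<in> {0..1}"
  shows "mat_path M t $ k = (\<Sum>q<CARD('n). M $ k $ enum_of q *
    clamp01 (real CARD('n) * clamp01 (real CARD('n) * t - real q) - real (slot_of k)))"
  using assms by (simp add: mat_path_def concat_paths_def enum_of_def col_path_nth flip: clamp01_def)

lemma continuous_on_mat_path: "continuous_on {0..1} (mat_path (M :: 'n::{finite,linorder} matrix))"
proof -
  have "continuous_on {0..1} (\<lambda>t. \<chi> k. \<Sum>q<CARD('n). M $ k $ enum_of q *
      clamp01 (real CARD('n) * clamp01 (real CARD('n) * t - real q) - real (slot_of k)))"
    by (intro continuous_intros)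
  then show ?thesis
    by (rule continuous_on_eq) (simp add: vec_eq_iff mat_path_nth)
qed

lemma block_exists:
  assumes "t \<in> {0..1}" "0 < n"
  obtains j where "j < n" "real j \<le> real n * t" "real n * t \<le> real j + 1"
proof (cases "t = 1")
  case True
  with assms that[of "n - 1"] show ?thesis by (simp add: of_nat_diff)
next
  case False
  define j where "j = nat \<lfloor>real n * t\<rfloor>"
  have "0 \<le> real n * t" "real n * t < real n"
    using assms False by simp_all
  then have "real j \<le> real n * t" "real n * t < real j + 1" "real j < real n"
    unfolding j_def by linarith+
  then show ?thesis using that[of j] by simp
qed

text \<open>Within block \<open>j\<close> the earlier blocks are complete and the later ones have
  not begun; \<open>g q 0 = 0\<close> removes the latter.\<close>

lemma sum_blocks:
  fixes g :: "nat \<Rightarrow> real \<Rightarrow> 'a::comm_monoid_add"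
  assumes "j < n" "real j \<le> x" "x \<le> real j + 1" "\<And>q. g q 0 = 0"
  shows "(\<Sum>q<n. g q (clamp01 (x - q))) = (\<Sum>q<j. g q 1) + g j (x - j)"
proof -
  have "g q (clamp01 (x - q)) = (if q < j then g q 1 else if q = j then g j (x - j) else 0)"
    if "q < n" for q
    using assms by (auto simp: clamp01_eq)
  then have "(\<Sum>q<n. g q (clamp01 (x - q)))
      = (\<Sum>q<n. if q < j then g q 1 else if q = j then g j (x - j) else 0)"
    by simp
  also have "\<dots> = (\<Sum>q<Suc j. if q < j then g q 1 else if q = j then g j (x - j) else 0)"
    using assms(1) by (intro sum.mono_neutral_right) auto
  finally show ?thesis by simp
qed

section \<open>Running minima as queues\<close>

text \<open>
  Reading column \<open>q\<close>, the \<open>h_i\<close>-component of the path of a matrix first falls by \<open>d q = m_(i+1,q)\<close>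
  and then rises by \<open>a q = m_(i,q)\<close>.  Its height above the running minimum is thus the length of
  a queue with services \<open>d q\<close> followed by arrivals \<open>a q\<close>.
\<close>

fun queue :: "(nat \<Rightarrow> real) \<Rightarrow> (nat \<Rightarrow> real) \<Rightarrow> nat \<Rightarrow> real" where
  "queue a d 0 = 0"
| "queue a d (Suc q) = a q + max 0 (queue a d q - d q)"

lemma queue_nonneg: "(\<And>q. 0 \<le> a q) \<Longrightarrow> 0 \<le> queue a d q"
  by (induction q) (auto intro: add_nonneg_nonneg)

text \<open>The discrete Skorokhod reflection: the queue length is the free walk plus the service
  wasted so far, and the wasted service is minus the running minimum of the walk.\<close>

lemma queue_eq:
  "queue a d j = (\<Sum>q<j. a q - d q) + (\<Sum>q<j. max 0 (d q - queue a d q))"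
  by (induction j) auto

text \<open>Here \<open>r\<close> is the slot of row \<open>nxt i\<close>, and row \<open>i\<close>
  follows in slot \<open>Suc r\<close>. The minimum drops by the wasted service. The proof exhibits
  \<rho> as a nonincreasing lower bound of \<open>h\<close> and then a time up to \<open>t\<close>
  at which \<open>h\<close> takes the value \<open>\<rho> t\<close>.\<close>

lemma INF_queue:
  fixes a d :: "nat \<Rightarrow> real" and t :: real
  assumes n: "r + 1 < n" and a: "\<And>q. 0 \<le> a q" and d: "\<And>q. 0 \<le> d q" and t: "t \<in> {0..1}"
  defines "h \<equiv> \<lambda>t::real. \<Sum>q<n. a q * clamp01 (real n * clamp01 (real n * t - real q) - real (Suc r))
      - d q * clamp01 (real n * clamp01 (real n * t - real q) - real r)"
  shows "(INF s\<in>{0..t}. h s)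
    = - (\<Sum>q<n. max 0 (d q * clamp01 (real n * clamp01 (real n * t - real q) - real r) - queue a d q))"
proof -
  let ?D = "queue a d" and ?x = "\<lambda>q. max 0 (d q - queue a d q)"
  define U V where "U t q = clamp01 (real n * clamp01 (real n * t - real q) - real (Suc r))"
    and "V t q = clamp01 (real n * clamp01 (real n * t - real q) - real r)" for t :: real and q :: nat
  define \<rho> where "\<rho> t = - (\<Sum>q<n. max 0 (d q * V t q - ?D q))" for t :: real
  have D0: "0 \<le> ?D q" for q using queue_nonneg a by blast
  have h: "h t = (\<Sum>q<n. a q * U t q - d q * V t q)" for t
    by (simp add: h_def U_def V_def)
  have block: "h s = ?D j - (\<Sum>q<j. ?x q) + a j * clamp01 (real n * (real n * s - real j) - real (Suc r))
        - d j * clamp01 (real n * (real n * s - real j) - real r)"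
      "\<rho> s = - (\<Sum>q<j. ?x q) - max 0 (d j * clamp01 (real n * (real n * s - real j) - real r) - ?D j)"
    if "j < n" "real j \<le> real n * s" "real n * s \<le> real j + 1" for s j
  proof -
    have one: "clamp01 (real n - real (Suc r)) = 1" "clamp01 (real n - real r) = 1"
      using n by (auto intro!: clamp01_eq(2))
    have "h s = (\<Sum>q<j. a q - d q) + (a j * clamp01 (real n * (real n * s - real j) - real (Suc r))
        - d j * clamp01 (real n * (real n * s - real j) - real r))"
      unfolding h U_def V_def
      by (subst sum_blocks[OF that, where g = "\<lambda>q s. a q * clamp01 (real n * s - real (Suc r))
          - d q * clamp01 (real n * s - real r)"]) (simp_all add: clamp01_eq(1) one[simplified])
    then show "h s = ?D j - (\<Sum>q<j. ?x q) + a j * clamp01 (real n * (real n * s - real j) - real (Suc r))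
        - d j * clamp01 (real n * (real n * s - real j) - real r)"
      using queue_eq[of a d j] by simp
    have "(\<Sum>q<n. max 0 (d q * V s q - ?D q))
        = (\<Sum>q<j. ?x q) + max 0 (d j * clamp01 (real n * (real n * s - real j) - real r) - ?D j)"
      unfolding V_def
      by (subst sum_blocks[OF that, where g = "\<lambda>q s. max 0 (d q * clamp01 (real n * s - real r) - ?D q)"])
        (simp_all add: clamp01_eq(1) one D0)
    then show "\<rho> s = - (\<Sum>q<j. ?x q) - max 0 (d j * clamp01 (real n * (real n * s - real j) - real r) - ?D j)"
      by (simp add: \<rho>_def)
  qed
  have "0 < n" using n by simp
  have lower: "\<rho> s \<le> h s" if s: "s \<in> {0..1}" for s
  proof -
    obtain j where j: "j < n" "real j \<le> real n * s" "real n * s \<le> real j + 1"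
      using block_exists[OF s \<open>0 < n\<close>] .
    show ?thesis
      using block[OF j] D0[of j]
        mult_nonneg_nonneg[OF a[of j] clamp01_bounds(1)[of "real n * (real n * s - real j) - real (Suc r)"]]
      by simp
  qed
  have anti: "\<rho> t \<le> \<rho> s" if "s \<le> t" for s t
  proof -
    have "V s q \<le> V t q" for q
      unfolding V_def using that by (intro clamp01_mono diff_right_mono mult_left_mono) auto
    then have "max 0 (d q * V s q - ?D q) \<le> max 0 (d q * V t q - ?D q)" for q
      using d by (intro max.mono diff_right_mono mult_left_mono) auto
    then show ?thesis
      unfolding \<rho>_def by (simp add: sum_mono)
  qed
  \<comment> \<open>\<open>T j\<close> is the time in block \<open>j\<close> at which slot
    \<open>r\<close> ends and slot \<open>Suc r\<close> begins: \<open>d j\<close> has been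
    subtracted in full and \<open>a j\<close> not yet added, so \<open>h\<close> is minimal over the
    block.\<close>
  define T where "T j = (real j + real (Suc r) / n) / n" for j
  have T: "real n * T j = real j + real (Suc r) / n" "real (Suc r) / n \<le> 1" for j
    using n by (auto simp: T_def)
  \<comment> \<open>Inductively, a block either keeps the old record minimum or sets a new one at
    \<open>T j\<close>.\<close>
  have att: "\<exists>s. 0 \<le> s \<and> real n * s \<le> real j \<and> h s = - (\<Sum>q<j. ?x q)" if "j \<le> n" for j
    using that
  proof (induction j)
    case 0
    show ?case
      using block(1)[of 0 0] \<open>0 < n\<close> by (intro exI[of _ 0]) (simp add: clamp01_eq(1))
  next
    case (Suc j)
    show ?case
    proof (cases "d j \<le> ?D j")
      case True
      then show ?thesis using Suc by force
    next
      case False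
      have "real n * (real n * T j - real j) = real (Suc r)" using T n by simp
      then have "h (T j) = - (\<Sum>q<Suc j. ?x q)"
        using block(1)[of j "T j"] T(1)[of j] T(2) False Suc.prems by (simp add: clamp01_eq)
      moreover have "0 \<le> T j" by (simp add: T_def)
      ultimately show ?thesis using T(1)[of j] T(2) by (intro exI[of _ "T j"]) auto
    qed
  qed
  obtain j where j: "j < n" "real j \<le> real n * t" "real n * t \<le> real j + 1"
    using block_exists[OF t \<open>0 < n\<close>] .
  let ?V = "clamp01 (real n * (real n * t - real j) - real r)"
  have "\<exists>s\<in>{0..t}. h s = \<rho> t"
  proof (cases "d j * ?V \<le> ?D j")
    case True
    obtain s where s: "0 \<le> s" "real n * s \<le> real j" "h s = - (\<Sum>q<j. ?x q)"
      using att[of j] j by auto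
    have "s \<le> t" using s(2) j(2) \<open>0 < n\<close> by (meson mult_le_cancel_left_pos of_nat_0_less_iff order_trans)
    then show ?thesis using s block(2)[OF j] True by (intro bexI[of _ s]) auto
  next
    case False
    \<comment> \<open>In block \<open>j\<close> the function \<open>h\<close> does not rise before
      \<open>T j\<close> and does not fall after it, so the record is set at \<open>t\<close> or,
      once \<open>t\<close> has passed \<open>T j\<close>, at \<open>T j\<close>.\<close>
    define s where "s = min t (T j)"
    have "real n * s = min (real n * t) (real n * T j)"
      by (simp add: s_def min_mult_distrib_left)
    then have ns: "real n * s = min (real n * t) (real j + real (Suc r) / n)"
      using T by simp
    then have sj: "real j \<le> real n * s" "real n * s \<le> real j + 1"
      using j by auto
    have "real n * (real n * s - real j) = min (real n * (real n * t - real j)) (real (Suc r))"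
      using ns n by (auto simp: min_def field_simps)
    then have "clamp01 (real n * (real n * s - real j) - real (Suc r)) = 0" "clamp01 (real n * (real n * s - real j) - real r) = ?V"
      by (auto simp: clamp01_def)
    then have "h s = \<rho> t"
      using block(1)[OF j(1) sj] block(2)[OF j] False by simp
    moreover have "0 \<le> s" using t by (simp add: s_def T_def)
    ultimately show ?thesis by (intro bexI[of _ s]) (auto simp: s_def)
  qed
  then obtain s where s: "s \<in> {0..t}" "h s = \<rho> t" by blast
  have "(INF s\<in>{0..t}. h s) = h s"
  proof (rule INF_eq_minimum[OF s(1)])
    fix u assume u: "u \<in> {0..t}"
    have "\<rho> t \<le> \<rho> u" using u anti by simp
    also have "\<dots> \<le> h u" using lower[of u] u t by simp
    finally show "h s \<le> h u" using s by simp
  qed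
  then show ?thesis
    using s(2) by (simp add: \<rho>_def V_def)
qed

section \<open>The maximal raising operator on matrices\<close>

abbreviation row_queue :: "'n::{finite,linorder} \<Rightarrow> 'n matrix \<Rightarrow> nat \<Rightarrow> real" where
  "row_queue i M \<equiv> queue (\<lambda>q. M $ i $ enum_of q) (\<lambda>q. M $ nxt i $ enum_of q)"

text \<open>In each column the service wasted on an empty queue moves from row \<open>nxt i\<close>
  up to row \<open>i\<close>; the \<open>min\<close> is what remains, since d - max 0 (d - D) = min
  d D.\<close>

definition mat_emax :: "'n::{finite,linorder} \<Rightarrow> 'n matrix \<Rightarrow> 'n matrix" where
  "mat_emax i M = (\<chi> k j.
     if k = i then M $ i $ j + max 0 (M $ nxt i $ j - row_queue i M (index_of j))
     else if k = nxt i then min (M $ nxt i $ j) (row_queue i M (index_of j))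
     else M $ k $ j)"

lemma row_queue_nonneg: "M \<in> Mats \<Longrightarrow> 0 \<le> row_queue i M q"
  by (rule queue_nonneg) (simp add: Mats_def)

lemma mat_emax_in_Mats: "M \<in> Mats \<Longrightarrow> mat_emax i M \<in> Mats"
  using row_queue_nonneg[of M i] by (auto simp: Mats_def mat_emax_def)

lemma pair_h_mat_path:
  fixes M :: "'n::{finite,linorder} matrix" and t :: real
  assumes "i \<in> simple_index" "t \<in> {0..1}"
  shows "pair_h i (mat_path M t) = (\<Sum>q<CARD('n).
    M $ i $ enum_of q * clamp01 (real CARD('n) * clamp01 (real CARD('n) * t - real q)
      - real (Suc (slot_of (nxt i))))
    - M $ nxt i $ enum_of q * clamp01 (real CARD('n) * clamp01 (real CARD('n) * t - real q)
      - real (slot_of (nxt i))))"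
  using assms by (simp add: pair_h_def coroot_def mat_path_nth slot_of_nxt sum_subtractf)

lemma INF_mat_path:
  fixes M :: "'n::{finite,linorder} matrix" and t :: real
  assumes M: "M \<in> Mats" and i: "i \<in> simple_index" and t: "t \<in> {0..1}"
  shows "(INF s\<in>{0..t}. pair_h i (mat_path M s)) = - (\<Sum>q<CARD('n).
    max 0 (M $ nxt i $ enum_of q * clamp01 (real CARD('n) * clamp01 (real CARD('n) * t - real q)
      - real (slot_of (nxt i))) - row_queue i M q))"
proof -
  have "slot_of (nxt i) + 1 < CARD('n)"
    using slot_of_less[of i] slot_of_nxt[OF i] by simp
  note INF = INF_queue[OF this _ _ t, of "\<lambda>q. M $ i $ enum_of q" "\<lambda>q. M $ nxt i $ enum_of q"]
  have "(\<lambda>s. pair_h i (mat_path M s)) ` {0..t} = (\<lambda>s. \<Sum>q<CARD('n).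
    M $ i $ enum_of q * clamp01 (real CARD('n) * clamp01 (real CARD('n) * s - real q)
      - real (Suc (slot_of (nxt i))))
    - M $ nxt i $ enum_of q * clamp01 (real CARD('n) * clamp01 (real CARD('n) * s - real q)
      - real (slot_of (nxt i)))) ` {0..t}"
    using t by (intro image_cong refl pair_h_mat_path[OF i]) auto
  then show ?thesis
    using INF M by (simp only: Mats_def mem_Collect_eq)
qed

lemma clamp01_slot_1:
  fixes k :: "'n::{finite,linorder}"
  assumes "q < CARD('n)"
  shows "clamp01 (real CARD('n) * clamp01 (real CARD('n) - real q) - real (slot_of k)) = 1"
proof -
  have "1 \<le> real CARD('n) - real q" "1 \<le> real CARD('n) - real (slot_of k)"
    using assms slot_of_less[of k] by linarith+
  then show ?thesis by (simp add: clamp01_eq(2))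
qed

lemma path_min_mat_path:
  fixes M :: "'n::{finite,linorder} matrix"
  assumes "M \<in> Mats" "i \<in> simple_index"
  shows "path_min i (mat_path M)
    = - (\<Sum>q<CARD('n). max 0 (M $ nxt i $ enum_of q - row_queue i M q))"
  using INF_mat_path[OF assms, of 1] by (simp add: path_min_def clamp01_slot_1)

lemma mat_path_1: "mat_path M 1 $ k = (\<Sum>j\<in>UNIV. M $ k $ j)"
  using sum_enum_of[of "\<lambda>j. M $ k $ j"] by (simp add: mat_path_nth clamp01_slot_1)

lemma mat_path_0: "mat_path M 0 = 0"
  by (simp add: vec_eq_iff mat_path_nth clamp01_eq(1))

text \<open>This is \<open>queue_eq\<close> after the last column: the net input is the pairing of
  the endpoint, and the wasted service is eps_i.\<close>

lemma path_phi_mat_path: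
  fixes M :: "'n::{finite,linorder} matrix"
  assumes "M \<in> Mats" "i \<in> simple_index"
  shows "path_phi i (mat_path M) = row_queue i M CARD('n)"
  unfolding queue_eq[of _ _ "CARD('n)"]
  by (simp add: path_phi_def path_eps_def path_min_mat_path[OF assms] pair_h_def coroot_def
      mat_path_1 sum_subtractf flip: sum_enum_of)

text \<open>A column is filled from the bottom row upwards, so coordinate \<open>k\<close> depends
  on the time only through the length travelled: it takes what exceeds the total of the rows below,
  up to \<open>v k\<close>. This makes columns traversed at different speeds comparable.\<close>

lemma column_curve:
  fixes v :: "'n::{finite,linorder} \<Rightarrow> real"
  assumes v: "\<And>k. 0 \<le> v k"
  shows "min (v k) (max 0 ((\<Sum>m\<in>UNIV. v m * clamp01 (x - real (slot_of m))) - (\<Sum>m\<in>{k<..}. v m)))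
    = v k * clamp01 (x - real (slot_of k))"
proof -
  let ?c = "\<lambda>m. clamp01 (x - real (slot_of m))"
  have "(UNIV :: 'n set) = {k<..} \<union> ({k} \<union> {..<k})" by auto
  then have "(\<Sum>m\<in>UNIV. v m * ?c m) = (\<Sum>m\<in>{k<..} \<union> ({k} \<union> {..<k}). v m * ?c m)"
    by simp
  also have "\<dots> = (\<Sum>m\<in>{k<..}. v m * ?c m) + (v k * ?c k + (\<Sum>m\<in>{..<k}. v m * ?c m))"
    by (subst sum.union_disjoint; auto)
  finally have F: "(\<Sum>m\<in>UNIV. v m * ?c m)
      = (\<Sum>m\<in>{k<..}. v m * ?c m) + v k * ?c k + (\<Sum>m\<in>{..<k}. v m * ?c m)"
    by simp
  have up: "real (slot_of k) + 1 \<le> real (slot_of m)" if "m < k" for m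
    using slot_of_less_iff[of k m] that by linarith
  have down: "real (slot_of m) + 1 \<le> real (slot_of k)" if "k < m" for m
    using slot_of_less_iff[of m k] that by linarith
  have vc: "0 \<le> v m * ?c m" "v m * ?c m \<le> v m" for m
    using v[of m] by (auto intro: mult_right_le_one_le)
  consider "x - real (slot_of k) \<le> 0" | "0 \<le> x - real (slot_of k)" "x - real (slot_of k) \<le> 1"
    | "1 \<le> x - real (slot_of k)" by linarith
  then show ?thesis
  proof cases
    case 1
    have "?c m = 0" if "m < k" for m
      using up[OF that] 1 by (intro clamp01_eq(1)) simp
    then have "(\<Sum>m\<in>{..<k}. v m * ?c m) = 0" by simp
    moreover have "(\<Sum>m\<in>{k<..}. v m * ?c m) \<le> (\<Sum>m\<in>{k<..}. v m)"
      by (intro sum_mono vc)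
    ultimately show ?thesis
      using F 1 v[of k] by (simp add: clamp01_eq(1))
  next
    case 2
    have "?c m = 0" if "m < k" for m
      using up[OF that] 2 by (intro clamp01_eq(1)) simp
    then have "(\<Sum>m\<in>{..<k}. v m * ?c m) = 0" by simp
    moreover have "?c m = 1" if "k < m" for m
      using down[OF that] 2 by (intro clamp01_eq(2)) simp
    then have "(\<Sum>m\<in>{k<..}. v m * ?c m) = (\<Sum>m\<in>{k<..}. v m)" by simp
    ultimately show ?thesis
      using F vc[of k] by simp
  next
    case 3
    have "?c m = 1" if "k < m" for m
      using down[OF that] 3 by (intro clamp01_eq(2)) simp
    then have "(\<Sum>m\<in>{k<..}. v m * ?c m) = (\<Sum>m\<in>{k<..}. v m)" by simp
    moreover have "0 \<le> (\<Sum>m\<in>{..<k}. v m * ?c m)"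
      by (intro sum_nonneg vc)
    ultimately show ?thesis
      using F 3 v[of k] by (simp add: clamp01_eq(2))
  qed
qed

text \<open>Reparametrizes block \<open>q\<close> by \<open>\<phi> q\<close>. If every
  \<open>\<phi> q\<close> fixes 0 and 1, the junction times stay fixed, as \<open>reparam\<close>
  demands.\<close>

definition blockwise :: "nat \<Rightarrow> (nat \<Rightarrow> real \<Rightarrow> real) \<Rightarrow> real \<Rightarrow> real" where
  "blockwise n \<phi> t = (\<Sum>q<n. \<phi> q (clamp01 (real n * t - real q))) / real n"

lemma clamp01_blockwise:
  assumes t: "t \<in> {0..1}" and q: "q < n"
    and \<phi>: "\<And>q. \<phi> q 0 = 0" "\<And>q. \<phi> q 1 = 1" "\<And>q. mono_on {0..1} (\<phi> q)"
  shows "clamp01 (real n * blockwise n \<phi> t - real q) = \<phi> q (clamp01 (real n * t - real q))"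
proof -
  obtain j where j: "j < n" "real j \<le> real n * t" "real n * t \<le> real j + 1"
    using block_exists[OF t, of n] q by auto
  have "real n * blockwise n \<phi> t = (\<Sum>q<j. \<phi> q 1) + \<phi> j (real n * t - real j)"
    using q sum_blocks[OF j, where g = \<phi>] \<phi>(1) by (simp add: blockwise_def)
  then have eq: "real n * blockwise n \<phi> t = real j + \<phi> j (real n * t - real j)"
    by (simp add: \<phi>(2))
  have "0 \<le> \<phi> j (real n * t - real j)" "\<phi> j (real n * t - real j) \<le> 1"
    using mono_onD[OF \<phi>(3), of 0 "real n * t - real j" j] mono_onD[OF \<phi>(3), of "real n * t - real j" 1 j]
      \<phi>(1,2) j by simp_all
  then show ?thesis
    unfolding eq using j by (cases q j rule: linorder_cases) (auto simp: clamp01_eq \<phi>(1,2))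
qed

lemma blockwise_reparam:
  assumes "0 < n" and \<phi>: "\<And>q. \<phi> q 0 = 0" "\<And>q. \<phi> q 1 = 1" "\<And>q. mono_on {0..1} (\<phi> q)"
    and cont: "\<And>q. continuous_on {0..1} (\<phi> q)"
  shows "blockwise n \<phi> \<in> reparam n"
proof -
  have "continuous_on {0..1} (\<lambda>t. \<phi> q (clamp01 (real n * t - real q)))" for q
    by (rule continuous_on_compose2[OF cont]) (auto intro!: continuous_intros)
  then have "continuous_on {0..1} (blockwise n \<phi>)"
    using \<open>0 < n\<close> unfolding blockwise_def by (intro continuous_intros) auto
  moreover have "mono_on {0..1} (blockwise n \<phi>)"
    unfolding blockwise_def
    by (intro mono_onI divide_right_mono sum_mono mono_onD[OF \<phi>(3)] clamp01_mono
        diff_right_mono mult_left_mono) auto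
  moreover have "blockwise n \<phi> (real j / real n) = real j / real n" if "j \<le> n" for j
  proof -
    have "\<phi> q (clamp01 (real j - real q)) = (if q < j then 1 else 0)" for q
      by (auto simp: clamp01_eq \<phi>(1,2))
    then have "(\<Sum>q<n. \<phi> q (clamp01 (real j - real q))) = (\<Sum>q<n. if q < j then 1 else 0)"
      by simp
    also have "\<dots> = real (card ({..<n} \<inter> {q. q < j}))"
      by (simp add: sum.If_cases)
    also have "{..<n} \<inter> {q. q < j} = {..<j}" using that by auto
    finally show ?thesis
      using \<open>0 < n\<close> by (simp add: blockwise_def)
  qed
  ultimately show ?thesis by (simp add: reparam_def)
qed

definition col_sum :: "'n::{finite,linorder} matrix \<Rightarrow> nat \<Rightarrow> real" where
  "col_sum M q = (\<Sum>k\<in>UNIV. M $ k $ enum_of q)"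

text \<open>Normalized arc length of column \<open>q\<close> of the path of \<open>M\<close>.\<close>

definition col_time :: "'n::{finite,linorder} matrix \<Rightarrow> nat \<Rightarrow> real \<Rightarrow> real" where
  "col_time M q s = (if col_sum M q = 0 then s else
     (\<Sum>k\<in>UNIV. M $ k $ enum_of q * clamp01 (real CARD('n) * s - real (slot_of k))) / col_sum M q)"

lemma col_sum_eq_0:
  assumes "M \<in> Mats" "col_sum M q = 0"
  shows "M $ k $ enum_of q = 0"
  using assms by (simp add: col_sum_def Mats_def sum_nonneg_eq_0_iff)

lemma col_sum_times_col_time:
  fixes M :: "'n::{finite,linorder} matrix"
  assumes "M \<in> Mats"
  shows "col_sum M q * col_time M q s
    = (\<Sum>k\<in>UNIV. M $ k $ enum_of q * clamp01 (real CARD('n) * s - real (slot_of k)))"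
  using col_sum_eq_0[OF assms] by (auto simp: col_time_def)

text \<open>A zero column has no length to normalize; there \<open>col_time\<close> is the identity,
  so these properties hold for every column.\<close>

lemma col_time_props:
  fixes M :: "'n::{finite,linorder} matrix"
  assumes M: "M \<in> Mats"
  shows "col_time M q 0 = 0" "col_time M q 1 = 1" "mono_on {0..1} (col_time M q)"
    "continuous_on {0..1} (col_time M q)"
proof -
  show "col_time M q 0 = 0"
    by (simp add: col_time_def clamp01_eq(1))
  have "clamp01 (real CARD('n) - real (slot_of k)) = 1" for k :: 'n
    using slot_of_less[of k] by (intro clamp01_eq(2)) linarith
  then show "col_time M q 1 = 1"
    by (simp add: col_time_def flip: col_sum_def)
  have "0 \<le> col_sum M q"
    using M by (simp add: col_sum_def Mats_def sum_nonneg)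
  then show "mono_on {0..1} (col_time M q)"
    using M unfolding col_time_def
    by (auto intro!: mono_onI divide_right_mono sum_mono mult_left_mono clamp01_mono simp: Mats_def)
  show "continuous_on {0..1} (col_time M q)"
    unfolding col_time_def by (cases "col_sum M q = 0") (auto intro!: continuous_intros)
qed

text \<open>What leaves row \<open>nxt i\<close> enters row \<open>i\<close>. With all rows this
  says that the length of a column is preserved; with the rows below \<open>k\<close>, for
  \<open>k\<close> other than \<open>i\<close>, that row \<open>k\<close> starts at the same length
  as before.\<close>

lemma sum_mat_emax:
  assumes "i \<in> simple_index" "i \<in> S \<longleftrightarrow> nxt i \<in> S"
  shows "(\<Sum>k\<in>S. mat_emax i M $ k $ j) = (\<Sum>k\<in>S. M $ k $ j)"
proof (cases "i \<in> S")
  case True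
  define x where "x = max 0 (M $ nxt i $ j - row_queue i M (index_of j))"
  have "mat_emax i M $ k $ j = M $ k $ j + x * \<alpha> i $ k" for k
    using nxt_greater[OF assms(1)] by (auto simp: mat_emax_def \<alpha>_nth[OF assms(1)] x_def)
  moreover have "(\<Sum>k\<in>S. \<alpha> i $ k) = (\<Sum>k\<in>{i, nxt i}. \<alpha> i $ k)"
    using assms True by (intro sum.mono_neutral_right) (auto simp: \<alpha>_nth)
  moreover have "\<dots> = 0"
    using nxt_greater[OF assms(1)] by (simp add: \<alpha>_nth[OF assms(1)])
  ultimately show ?thesis
    by (simp add: sum.distrib flip: sum_distrib_left)
next
  case False
  then show ?thesis
    using assms by (intro sum.cong) (auto simp: mat_emax_def)
qed

text \<open>While row \<open>nxt i\<close> of a column is read, the running minimum is constant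
  until the queue is used up; the rest of the entry makes new minima and is turned into the
  direction of row \<open>i\<close>, which is read next. The result is the corresponding column of
  \<open>mat_emax i M\<close>, but at another speed. Both paths are therefore compared with one
  traversed by length.\<close>

lemma path_emax_mat_path_same:
  fixes M :: "'n::{finite,linorder} matrix"
  assumes M: "M \<in> Mats" and i: "i \<in> simple_index"
  shows "same_upto_reparam CARD('n) (path_emax i (mat_path M)) (mat_path (mat_emax i M))"
proof -
  let ?n = "CARD('n)" and ?M' = "mat_emax i M"
  have M': "?M' \<in> Mats" using mat_emax_in_Mats[OF M] .
  define rest where "rest k q = (\<Sum>m\<in>{k<..}. ?M' $ m $ enum_of q)" for k :: 'n and q :: nat
  \<comment> \<open>The common path: each column of \<open>?M'\<close> traversed at constant speed,
    written by the formula of \<open>column_curve\<close>.\<close>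
  define c where "c = (\<lambda>t\<in>{0..1}. (\<chi> k. \<Sum>q<?n. min (?M' $ k $ enum_of q)
      (max 0 (col_sum M q * clamp01 (real ?n * t - real q) - rest k q))) :: 'n weight)"
  have col_sum': "col_sum ?M' q = col_sum M q" for q
    using sum_mat_emax[OF i, of UNIV M] by (simp add: col_sum_def)
  have "continuous_on {0..1} (\<lambda>t. (\<chi> k. \<Sum>q<?n. min (?M' $ k $ enum_of q)
      (max 0 (col_sum M q * clamp01 (real ?n * t - real q) - rest k q))) :: 'n weight)"
    by (intro continuous_intros)
  then have "continuous_on {0..1} c"
    by (rule continuous_on_eq) (simp add: c_def)
  then have "c \<in> paths"
    by (simp add: paths_def c_def)
  moreover have rep: "blockwise ?n (col_time N) \<in> reparam ?n" if "N \<in> Mats" for N :: "'n matrix"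
    by (rule blockwise_reparam) (simp_all add: col_time_props that)
  moreover have unit: "blockwise ?n (col_time N) t \<in> {0..1}"
    if "N \<in> Mats" "t \<in> {0..1}" for N :: "'n matrix" and t
  proof -
    have "0 \<le> col_time N q (clamp01 (real ?n * t - real q))"
      "col_time N q (clamp01 (real ?n * t - real q)) \<le> 1" for q
      using mono_onD[OF col_time_props(3)[OF that(1)], of 0 "clamp01 (real ?n * t - real q)" q]
        mono_onD[OF col_time_props(3)[OF that(1)], of "clamp01 (real ?n * t - real q)" 1 q]
      by (simp_all add: col_time_props[OF that(1)])
    note bounds = this
    have "0 \<le> (\<Sum>q<?n. col_time N q (clamp01 (real ?n * t - real q)))"
      by (intro sum_nonneg bounds)
    moreover have "(\<Sum>q<?n. col_time N q (clamp01 (real ?n * t - real q))) \<le> (\<Sum>q<?n. 1)"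
      by (intro sum_mono bounds)
    ultimately show ?thesis by (simp add: blockwise_def)
  qed
  have c_eq: "c (blockwise ?n (col_time N) t) $ k = (\<Sum>q<?n. min (?M' $ k $ enum_of q) (max 0
      ((\<Sum>m\<in>UNIV. N $ m $ enum_of q * clamp01 (real ?n * clamp01 (real ?n * t - real q)
        - real (slot_of m))) - rest k q)))"
    if "N \<in> Mats" "t \<in> {0..1}" "\<And>q. col_sum N q = col_sum M q" for N :: "'n matrix" and t k
    using unit[OF that(1,2)] that
    by (simp add: c_def clamp01_blockwise col_time_props flip: that(3) col_sum_times_col_time)
  have "mat_path ?M' t = c (blockwise ?n (col_time ?M') t)" if t: "t \<in> {0..1}" for t
  proof -
    have "?M' $ k $ enum_of q * clamp01 (real ?n * clamp01 (real ?n * t - real q) - real (slot_of k))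
      = min (?M' $ k $ enum_of q) (max 0 ((\<Sum>m\<in>UNIV. ?M' $ m $ enum_of q *
          clamp01 (real ?n * clamp01 (real ?n * t - real q) - real (slot_of m))) - rest k q))" for k q
      using M' column_curve[of "\<lambda>m. ?M' $ m $ enum_of q" k "real ?n * clamp01 (real ?n * t - real q)"]
      by (simp add: Mats_def rest_def)
    then show ?thesis
      unfolding vec_eq_iff c_eq[OF M' t col_sum'] mat_path_nth[OF t]
      by (intro allI sum.cong refl)
  qed
  moreover have "path_emax i (mat_path M) t = c (blockwise ?n (col_time M) t)" if t: "t \<in> {0..1}" for t
  proof -
    have "path_emax i (mat_path M) t $ k = c (blockwise ?n (col_time M) t) $ k" for k
    proof -
      define V where "V q k = clamp01 (real ?n * clamp01 (real ?n * t - real q) - real (slot_of k))"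
        for q and k :: 'n
      define F where "F q = (\<Sum>m\<in>UNIV. M $ m $ enum_of q * V q m)" for q
      define tl where "tl k q = (\<Sum>m\<in>{k<..}. M $ m $ enum_of q)" for k :: 'n and q :: nat
      have curve: "M $ k $ enum_of q * V q k = min (M $ k $ enum_of q) (max 0 (F q - tl k q))" for k q
        using M unfolding V_def F_def tl_def by (subst column_curve) (auto simp: Mats_def)
      have lhs: "path_emax i (mat_path M) t $ k = (\<Sum>q<?n. M $ k $ enum_of q * V q k
          + max 0 (M $ nxt i $ enum_of q * V q (nxt i) - row_queue i M q) * \<alpha> i $ k)"
        using t by (simp add: path_emax_def mat_path_nth INF_mat_path[OF M i t] V_def sum.distrib
            sum_distrib_right)
      have "M $ k $ enum_of q * V q k
          + max 0 (M $ nxt i $ enum_of q * V q (nxt i) - row_queue i M q) * \<alpha> i $ k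
          = min (?M' $ k $ enum_of q) (max 0 (F q - rest k q))" if "q < ?n" for q
      proof -
        have iq: "index_of (enum_of q :: 'n) = q" using index_of_enum_of[OF that] .
        have D: "0 \<le> row_queue i M q" using row_queue_nonneg[OF M] .
        have Mp: "0 \<le> M $ m $ enum_of q" for m using M by (simp add: Mats_def)
        have between: "i < k \<Longrightarrow> nxt i \<le> k" for k using nxt_le by blast
        note lt = nxt_greater[OF i]
        \<comment> \<open>The rows below \<open>k\<close> contain exactly one of \<open>i\<close>
          and \<open>nxt i\<close> only for \<open>k = i\<close>.\<close>
        have tail: "rest k q = tl k q" if "k \<noteq> i" for k
          unfolding rest_def tl_def using that lt between[of k]
          by (intro sum_mat_emax[OF i], cases k i rule: linorder_cases)
             (auto dest: order.strict_trans)
        have split: "{i<..} = insert (nxt i) {nxt i<..}"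
          using lt between by (auto simp: le_less)
        have tails: "tl i q = M $ nxt i $ enum_of q + tl (nxt i) q"
          "rest i q = min (M $ nxt i $ enum_of q) (row_queue i M q) + tl (nxt i) q"
          using tail[of "nxt i"] lt unfolding tl_def rest_def split
          by (simp_all add: mat_emax_def iq)
        consider "k = i" | "k = nxt i" | "k \<noteq> i" "k \<noteq> nxt i" by blast
        then show ?thesis
        proof cases
          case 1
          then show ?thesis
            using lt D Mp[of i] Mp[of "nxt i"] unfolding curve 1 tails
            by (simp add: \<alpha>_nth[OF i] mat_emax_def iq) (simp add: min_def max_def)
        next
          case 2
          then show ?thesis
            using lt D Mp[of "nxt i"] tail[of "nxt i"] unfolding curve
            by (simp add: \<alpha>_nth[OF i] mat_emax_def iq) (simp add: min_def max_def)
        next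
          case 3
          then show ?thesis
            using tail[of k] unfolding curve by (simp add: \<alpha>_nth[OF i] mat_emax_def)
        qed
      qed
      then show ?thesis
        unfolding lhs c_eq[OF M t refl] by (simp add: F_def V_def)
    qed
    then show ?thesis by (simp add: vec_eq_iff)
  qed
  ultimately show ?thesis
    unfolding same_upto_reparam_def using rep[OF M] rep[OF M'] by blast
qed

section \<open>Recovering a matrix from its path\<close>

lemma mat_path_junction:
  fixes M :: "'n::{finite,linorder} matrix"
  assumes "j \<le> CARD('n)"
  shows "mat_path M (real j / real CARD('n)) $ k = (\<Sum>q<j. M $ k $ enum_of q)"
proof -
  have "clamp01 (real CARD('n) * clamp01 (real j - real q) - real (slot_of k)) = (if q < j then 1 else 0)"
    for q
    using slot_of_less[of k] by (auto simp: clamp01_eq)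
  then have "mat_path M (real j / real CARD('n)) $ k
      = (\<Sum>q<CARD('n). if q < j then M $ k $ enum_of q else 0)"
    using assms by (subst mat_path_nth) (auto simp: divide_le_eq intro!: sum.cong)
  also have "\<dots> = (\<Sum>q<j. M $ k $ enum_of q)"
    using assms by (intro sum.mono_neutral_cong_right) auto
  finally show ?thesis .
qed

lemma same_upto_reparam_junction:
  assumes "same_upto_reparam n p q" "0 < n" "j \<le> n"
  shows "p (real j / real n) = q (real j / real n)"
proof -
  have "real j / real n \<in> {0..1}" using assms(2,3) by simp
  then show ?thesis
    using assms by (auto simp: same_upto_reparam_def reparam_def)
qed

text \<open>Values at consecutive junctions differ by one column. Since \<open>reparam\<close> fixes
  the junctions, this yields the uniqueness behind the definite description in
  \<open>mat_e\<close>.\<close>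

lemma mat_path_junctions_inject:
  fixes M N :: "'n::{finite,linorder} matrix"
  assumes "\<And>j. j \<le> CARD('n) \<Longrightarrow>
    mat_path M (real j / real CARD('n)) = mat_path N (real j / real CARD('n))"
  shows "M = N"
proof -
  have "M $ k $ enum_of q = N $ k $ enum_of q" if "q < CARD('n)" for k q
    using arg_cong[OF assms[of q], of "\<lambda>v. v $ k"] arg_cong[OF assms[of "Suc q"], of "\<lambda>v. v $ k"] that
    by (simp add: mat_path_junction del: of_nat_Suc)
  then show ?thesis
    by (metis vec_eq_iff enum_of_index_of index_of_less)
qed

lemma mat_e_path_eps:
  fixes M :: "'n::{finite,linorder} matrix"
  assumes M: "M \<in> Mats" and i: "i \<in> simple_index"
  shows "mat_e i (path_eps i (mat_path M)) M = Some (mat_emax i M)"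
proof -
  let ?p = "path_emax i (mat_path M)"
  have same: "same_upto_reparam CARD('n) ?p (mat_path (mat_emax i M))"
    using path_emax_mat_path_same[OF M i] .
  have "(THE N. N \<in> Mats \<and> same_upto_reparam CARD('n) ?p (mat_path N)) = mat_emax i M"
  proof (rule the_equality)
    fix N assume N: "N \<in> Mats \<and> same_upto_reparam CARD('n) ?p (mat_path N)"
    show "N = mat_emax i M"
    proof (rule mat_path_junctions_inject)
      fix j assume "j \<le> CARD('n)"
      then show "mat_path N (real j / real CARD('n)) = mat_path (mat_emax i M) (real j / real CARD('n))"
        using same_upto_reparam_junction[OF same, of j] N
          same_upto_reparam_junction[of "CARD('n)" ?p "mat_path N" j] by simp
    qed
  qed (use same mat_emax_in_Mats[OF M] in simp)
  then show ?thesis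
    by (simp add: mat_e_def path_e_path_eps continuous_on_mat_path mat_path_0)
qed

section \<open>Lower triangular matrices\<close>

abbreviation mat_emax_sharp :: "'n::{finite,linorder} \<Rightarrow> 'n matrix \<Rightarrow> 'n matrix" where
  "mat_emax_sharp i M \<equiv> transpose (mat_emax i (transpose M))"

text \<open>The intermediate stage between e_i and its transposed version: one entry next to the
  diagonal is left free.\<close>

definition Mats_almost_low :: "'n::{finite,linorder} \<Rightarrow> 'n matrix set" where
  "Mats_almost_low i = {M \<in> Mats. \<forall>k j. k < j \<longrightarrow> \<not> (k = i \<and> j = nxt i) \<longrightarrow> M $ k $ j = 0}"

lemma transpose_nth [simp]: "transpose M $ k $ j = M $ j $ k"
  by (simp add: Finite_Cartesian_Product.transpose_def)

lemma transpose_in_Mats [simp]: "transpose M \<in> Mats \<longleftrightarrow> M \<in> Mats"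
  by (auto simp: Mats_def)

lemma Mats_nonneg: "M \<in> Mats \<Longrightarrow> 0 \<le> M $ k $ j"
  by (simp add: Mats_def)

lemma Mats_low_subset: "M \<in> Mats_low \<Longrightarrow> M \<in> Mats"
  by (simp add: Mats_low_def)

lemma Mats_lowD: "M \<in> Mats_low \<Longrightarrow> k < j \<Longrightarrow> M $ k $ j = 0"
  by (simp add: Mats_low_def)

lemma Mats_almost_lowD:
  "M \<in> Mats_almost_low i \<Longrightarrow> k < j \<Longrightarrow> k \<noteq> i \<or> j \<noteq> nxt i \<Longrightarrow> M $ k $ j = 0"
  by (auto simp: Mats_almost_low_def)

lemma Mats_almost_low_imp_low:
  "M \<in> Mats_almost_low i \<Longrightarrow> M $ i $ nxt i = 0 \<Longrightarrow> M \<in> Mats_low"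
  by (auto simp: Mats_almost_low_def Mats_low_def)

lemma row_queue_eq_0:
  fixes M :: "'n::{finite,linorder} matrix"
  assumes M: "M \<in> Mats" and z: "\<And>k. k < j \<Longrightarrow> M $ i $ k = 0"
  shows "row_queue i M (index_of j) = 0"
proof -
  have "row_queue i M q = 0" if "q \<le> index_of j" for q
    using that
  proof (induction q)
    case (Suc q)
    then have "q < CARD('n)" using index_of_less[of j] by linarith
    then have "enum_of q < j"
      using Suc.prems index_of_less_iff[of "enum_of q" j] by (simp add: index_of_enum_of)
    then show ?case
      using Suc z Mats_nonneg[OF M, of "nxt i" "enum_of q"] by simp
  qed simp
  then show ?thesis by simp
qed

lemma row_queue_CARD:
  fixes M :: "'n::{finite,linorder} matrix"
  assumes M: "M \<in> Mats" and z: "\<And>k. j < k \<Longrightarrow> M $ i $ k = 0" "\<And>k. j < k \<Longrightarrow> M $ nxt i $ k = 0"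
  shows "row_queue i M CARD('n) = row_queue i M (Suc (index_of j))"
proof -
  have "q \<le> CARD('n) \<longrightarrow> row_queue i M q = row_queue i M (Suc (index_of j))"
    if "Suc (index_of j) \<le> q" for q
    using that
  proof (induction q rule: dec_induct)
    case (step q)
    show ?case
    proof
      assume "Suc q \<le> CARD('n)"
      then have "q < CARD('n)" by simp
      then have "j < enum_of q"
        using step index_of_less_iff[of j "enum_of q"] by (simp add: index_of_enum_of)
      then show "row_queue i M (Suc q) = row_queue i M (Suc (index_of j))"
        using step.IH \<open>q < CARD('n)\<close> z row_queue_nonneg[OF M, of i q] by simp
    qed
  qed simp
  then show ?thesis using index_of_less[of j] by simp
qed

text \<open>In column \<open>j\<close> row \<open>i\<close> gains at most the entry of row
  \<open>nxt i\<close>, and this vanishes for \<open>j\<close> beyond \<open>nxt i\<close>. Only the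
  diagonal entry of row \<open>nxt i\<close> can move above the diagonal.\<close>

lemma mat_emax_low:
  assumes i: "i \<in> simple_index" and M: "M \<in> Mats_low"
  shows "mat_emax i M \<in> Mats_almost_low i"
proof -
  have "mat_emax i M $ k $ j = 0" if kj: "k < j" "\<not> (k = i \<and> j = nxt i)" for k j
  proof (cases "k = i")
    case True
    then have "nxt i < j" using kj nxt_le[of i j] by auto
    then show ?thesis
      using True kj Mats_lowD[OF M] row_queue_nonneg[OF Mats_low_subset[OF M]]
      by (simp add: mat_emax_def)
  next
    case False
    then show ?thesis
      using kj Mats_lowD[OF M] row_queue_nonneg[OF Mats_low_subset[OF M], of i "index_of j"]
      by (simp add: mat_emax_def)
  qed
  then show ?thesis
    using mat_emax_in_Mats[OF Mats_low_subset[OF M]] by (auto simp: Mats_almost_low_def)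
qed

text \<open>Column \<open>i\<close> is zero above the diagonal, so the transposed queue is still
  empty at row \<open>i\<close>, and the whole exceptional entry moves left onto the
  diagonal.\<close>

lemma mat_emax_sharp_almost_low:
  assumes i: "i \<in> simple_index" and N: "N \<in> Mats_almost_low i"
  shows "mat_emax_sharp i N \<in> Mats_low"
proof -
  let ?P = "transpose N"
  have P: "?P \<in> Mats" using N by (simp add: Mats_almost_low_def)
  note lt = nxt_greater[OF i]
  have "row_queue i ?P (index_of i) = 0"
    using Mats_almost_lowD[OF N] by (intro row_queue_eq_0[OF P]) auto
  moreover have "a \<le> i" if "a < nxt i" for a
    using that nxt_le[of i a] by (auto simp: not_le[symmetric])
  ultimately have "mat_emax i ?P $ b $ a = 0" if "a < b" for a b
    using that lt Mats_almost_lowD[OF N, of a b] Mats_almost_lowD[OF N, of a "nxt i"]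
      row_queue_nonneg[OF P, of i "index_of a"] Mats_nonneg[OF P, of "nxt i" i]
    by (cases "a = i") (auto simp: mat_emax_def dest: order.strict_trans)
  then show ?thesis
    using mat_emax_in_Mats[OF P] by (auto simp: Mats_low_def)
qed

text \<open>Right of column \<open>nxt i\<close> both rows vanish, so the queue no longer
  changes.\<close>

lemma row_queue_almost_low_CARD:
  fixes M :: "'n::{finite,linorder} matrix"
  assumes i: "i \<in> simple_index" and M: "M \<in> Mats_almost_low i"
  shows "row_queue i M CARD('n) = row_queue i M (Suc (index_of (nxt i)))"
  using M nxt_greater[OF i]
  by (intro row_queue_CARD) (auto simp: Mats_almost_low_def dest: order.strict_trans)

text \<open>Column \<open>nxt i\<close> brings no arrival, so a queue that is nonempty after it was
  longer than the diagonal entry served there; none of that entry moves up.\<close>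

lemma mat_emax_low_of_phi_pos:
  fixes M :: "'n::{finite,linorder} matrix"
  assumes i: "i \<in> simple_index" and M: "M \<in> Mats_low" and pos: "0 < row_queue i M CARD('n)"
  shows "mat_emax i M \<in> Mats_low"
proof -
  have a: "M $ i $ nxt i = 0" using Mats_lowD[OF M nxt_greater[OF i]] .
  have "M \<in> Mats_almost_low i" using M by (simp add: Mats_almost_low_def Mats_low_def)
  then have "0 < row_queue i M (Suc (index_of (nxt i)))"
    using row_queue_almost_low_CARD[OF i] pos by metis
  then have "mat_emax i M $ i $ nxt i = 0"
    using a by (simp add: mat_emax_def max_def split: if_splits)
  then show ?thesis
    using Mats_almost_low_imp_low mat_emax_low[OF i M] by blast
qed

text \<open>Entries only move up within a column. Where row \<open>i\<close> of the image vanishes,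
  nothing has moved, so row \<open>nxt i\<close> is unchanged there.\<close>

lemma mat_emax_lowD:
  assumes i: "i \<in> simple_index" and M: "M \<in> Mats" and low: "mat_emax i M \<in> Mats_low"
  shows "M \<in> Mats_low"
proof -
  have "M $ k $ j = 0" if "k < j" for k j
  proof (cases "k = i \<or> k = nxt i")
    case True
    then have "i < j" "k < j" using that nxt_greater[OF i] by auto
    then have "mat_emax i M $ i $ j = 0" "mat_emax i M $ k $ j = 0"
      using Mats_lowD[OF low] by auto
    then show ?thesis
      using True Mats_nonneg[OF M, of i j] Mats_nonneg[OF M, of "nxt i" j] nxt_greater[OF i]
      by (auto simp: mat_emax_def max_def min_def split: if_splits)
  next
    case False
    then show ?thesis using Mats_lowD[OF low that] by (simp add: mat_emax_def)
  qed
  then show ?thesis using M by (auto simp: Mats_low_def)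
qed

text \<open>Entries only move left, from column \<open>nxt i\<close> to column \<open>i\<close>; the
  only one that can reach the lower triangle from above the diagonal is that in row
  \<open>i\<close>. It is an arrival in the last relevant column of the row queue, so the empty
  final queue forces it to be 0.\<close>

lemma mat_emax_sharp_lowD:
  fixes M :: "'n::{finite,linorder} matrix"
  assumes i: "i \<in> simple_index" and M: "M \<in> Mats" and low: "mat_emax_sharp i M \<in> Mats_low"
    and phi: "row_queue i M CARD('n) = 0"
  shows "M \<in> Mats_low"
proof -
  note lt = nxt_greater[OF i]
  have E: "mat_emax i (transpose M) $ j $ k = 0" if "k < j" for k j
    using Mats_lowD[OF low that] by simp
  have "M $ k $ j = 0" if kj: "k < j" "\<not> (k = i \<and> j = nxt i)" for k j
  proof (cases "j = i \<or> j = nxt i")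
    case True
    then have "k < i" "k < j" using kj nxt_le[of i k] by force+
    then show ?thesis
      using E[of k i] E[of k j] True Mats_nonneg[OF M, of k i] Mats_nonneg[OF M, of k "nxt i"] lt
      by (auto simp: mat_emax_def max_def min_def split: if_splits)
  next
    case False
    then show ?thesis using E[OF kj(1)] by (simp add: mat_emax_def)
  qed
  then have al: "M \<in> Mats_almost_low i" using M by (auto simp: Mats_almost_low_def)
  have "row_queue i M (Suc (index_of (nxt i))) = 0"
    using row_queue_almost_low_CARD[OF i al] phi by metis
  then have "M $ i $ nxt i = 0"
    using Mats_nonneg[OF M, of i "nxt i"] by (simp add: max_def split: if_splits)
  then show ?thesis by (rule Mats_almost_low_imp_low[OF al])
qed

text \<open>Column by column from the left: the queue of row \<open>i\<close> is empty until its first arrival.\<close>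

lemma highest_weight_upper:
  fixes M :: "'n::{finite,linorder} matrix"
  assumes M: "M \<in> Mats" and eps: "\<And>i. i \<in> simple_index \<Longrightarrow> path_eps i (mat_path M) = 0"
    and "j < k"
  shows "M $ k $ j = 0"
  using assms(3)
proof (induction "index_of j" arbitrary: j k rule: less_induct)
  case less
  obtain i where i: "i \<in> simple_index" "nxt i = k" "j \<le> i"
    using nxt_exists[OF less.prems] .
  have "(\<Sum>q<CARD('n). max 0 (M $ nxt i $ enum_of q - row_queue i M q)) = 0"
    using eps[OF i(1)] by (simp add: path_eps_def path_min_mat_path[OF M i(1)])
  then have "max 0 (M $ nxt i $ enum_of (index_of j) - row_queue i M (index_of j)) = 0"
    using index_of_less[of j] by (subst (asm) sum_nonneg_eq_0_iff) (auto dest: bspec[of _ _ "index_of j"])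
  moreover have "row_queue i M (index_of j) = 0"
    using less.hyps i(3) by (intro row_queue_eq_0[OF M]) (simp add: order.strict_trans2)
  ultimately show ?case
    using i(2) Mats_nonneg[OF M, of k j] by simp
qed

section \<open>Lower triangularity in terms of initial and final directions\<close>

lemma bicrystal_iso_pairs:
  assumes "bicrystal_iso \<kappa>" "M \<in> Mats" "\<kappa> M = (l, p, q)"
  shows "l \<in> Cbar_poly" "p \<in> LS_paths l" "q \<in> LS_paths l"
proof -
  have "bij_betw \<kappa> Mats pairs"
    using assms(1) by (simp add: bicrystal_iso_def crystal_iso_def mat_crystal_def pairs_crystal_fst_def)
  then have "(l, p, q) \<in> pairs"
    using assms(2,3) bij_betwE by metis
  then show "l \<in> Cbar_poly" "p \<in> LS_paths l" "q \<in> LS_paths l"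
    by (auto simp: pairs_def)
qed

lemma bicrystal_iso_fst:
  fixes M :: "'n::{finite,linorder} matrix"
  assumes iso: "bicrystal_iso \<kappa>" and M: "M \<in> Mats" and eq: "\<kappa> M = (l, p, q)"
  shows "mat_path M 1 = p 1"
    and "i \<in> simple_index \<Longrightarrow> path_eps i (mat_path M) = path_eps i p"
    and "i \<in> simple_index \<Longrightarrow> row_queue i M CARD('n) = path_phi i p"
    and "i \<in> simple_index \<Longrightarrow> \<kappa> (mat_emax i M) = (l, path_emax i p, q)"
proof -
  have iso1: "crystal_iso mat_crystal pairs_crystal_fst \<kappa>"
    using iso by (simp add: bicrystal_iso_def)
  show "mat_path M 1 = p 1"
    using iso1 M eq
    by (auto simp: crystal_iso_def mat_crystal_def pairs_crystal_fst_def path_wt_def dest!: bspec)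
  assume i: "i \<in> simple_index"
  have ep: "path_eps i p = path_eps i (mat_path M) \<and> path_phi i p = path_phi i (mat_path M)"
    using iso1 M i eq unfolding crystal_iso_def mat_crystal_def pairs_crystal_fst_def
    by (metis (no_types, lifting) case_prod_conv crystal.select_convs)
  then show "path_eps i (mat_path M) = path_eps i p" by simp
  show "row_queue i M CARD('n) = path_phi i p"
    using ep path_phi_mat_path[OF M i] by simp
  have p: "p \<in> LS_paths l" using bicrystal_iso_pairs[OF iso M eq] by simp
  have "map_option (\<lambda>p'. (l, p', q)) (path_e i r p) = map_option \<kappa> (mat_e i r M)" for r
    using iso1 M i eq unfolding crystal_iso_def mat_crystal_def pairs_crystal_fst_def
    by (metis (no_types, lifting) case_prod_conv crystal.select_convs)
  moreover have "path_e i (path_eps i (mat_path M)) p = Some (path_emax i p)"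
    using path_e_path_eps[OF LS_paths_continuous[OF p] LS_paths_start[OF p], of i] ep by simp
  ultimately show "\<kappa> (mat_emax i M) = (l, path_emax i p, q)"
    using mat_e_path_eps[OF M i] by (metis option.inject option.map(2))
qed

lemma bicrystal_iso_snd:
  assumes iso: "bicrystal_iso \<kappa>" and M: "M \<in> Mats" and eq: "\<kappa> M = (l, p, q)"
    and i: "i \<in> simple_index"
  shows "\<kappa> (mat_emax_sharp i M) = (l, p, path_emax i q)"
proof -
  have iso2: "crystal_iso mat_crystal_sharp pairs_crystal_snd \<kappa>"
    using iso by (simp add: bicrystal_iso_def)
  have "M \<in> elts mat_crystal_sharp" using M by (simp add: mat_crystal_sharp_def)
  then have ep: "eps pairs_crystal_snd i (\<kappa> M) = eps mat_crystal_sharp i M"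
    and cop: "cop pairs_crystal_snd i r (\<kappa> M) = map_option \<kappa> (cop mat_crystal_sharp i r M)" for r
    using iso2 i by (simp_all add: crystal_iso_def)
  have q: "q \<in> LS_paths l" using bicrystal_iso_pairs[OF iso M eq] by simp
  have tM: "transpose M \<in> Mats" using M by simp
  have "path_eps i (mat_path (transpose M)) = path_eps i q"
    using ep by (simp add: eq pairs_crystal_snd_def mat_crystal_sharp_def mat_crystal_def)
  then have "path_e i (path_eps i (mat_path (transpose M))) q = Some (path_emax i q)"
    using path_e_path_eps[OF LS_paths_continuous[OF q] LS_paths_start[OF q], of i] by simp
  then show ?thesis
    using cop[of "path_eps i (mat_path (transpose M))"] mat_e_path_eps[OF tM i]
    by (simp add: eq pairs_crystal_snd_def mat_crystal_sharp_def)
qed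

lemma low_iff_orbit_ge:
  fixes \<kappa> :: "'n::{finite,linorder} matrix \<Rightarrow> 'n target"
  assumes iso: "bicrystal_iso \<kappa>"
    and diag: "\<And>l. l \<in> Cbar_poly \<Longrightarrow> \<kappa> (diag_mat l) = (l, line_path l, line_path l)"
    and "M \<in> Mats" "\<kappa> M = (l, p, q)"
  shows "M \<in> Mats_low \<longleftrightarrow> orbit_ge (LS_final l p) (LS_init l q)"
  using assms(3,4)
proof (induction "orbit_rank l (LS_init l p)" arbitrary: M p q rule: less_induct)
  case less
  note M = less.prems(1) and eq = less.prems(2)
  have l: "l \<in> Cbar_poly" and p: "p \<in> LS_paths l" and q: "q \<in> LS_paths l"
    using bicrystal_iso_pairs[OF iso M eq] by auto
  then have lC: "l \<in> Cbar" by (simp add: Cbar_poly_def)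
  let ?\<tau> = "LS_final l p" and ?\<nu> = "LS_init l q"
  show ?case
  proof (cases "LS_init l p \<in> Cbar")
    case True
    then have "LS_init l p = l"
      using decreasing_rearrangement_unique[OF lC _ LS_init_in_orbit[OF p]] by simp
    then have pl: "p = line_path l" by (rule LS_init_dominant[OF lC p])
    show ?thesis
    proof
      assume low: "M \<in> Mats_low"
      have "path_eps i (mat_path M) = 0" if "i \<in> simple_index" for i
      proof -
        have "0 \<le> pair_h i l" using lC that by (simp add: Cbar_def)
        then have "path_min i p = pair_h i (p 0)"
          unfolding path_min_def pl by (intro INF_eq_minimum) (auto simp: line_path_def)
        then show ?thesis
          using bicrystal_iso_fst(2)[OF iso M eq that] LS_paths_start[OF p] by (simp add: path_eps_def)
      qed
      \<comment> \<open>Being of highest weight makes \<open>M\<close> upper triangular, so it is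
        diagonal; its row sums, the weight of \<open>p\<close>, then identify the diagonal.\<close>
      then have off: "M $ k $ j = 0" if "k \<noteq> j" for k j
        using that highest_weight_upper[OF M, of j k] Mats_lowD[OF low, of k j] by (metis neqE)
      have "M $ k $ k = l $ k" for k
      proof -
        have "(\<Sum>j\<in>UNIV. M $ k $ j) = (\<Sum>j\<in>{k}. M $ k $ j)"
          using off by (intro sum.mono_neutral_right) auto
        then show ?thesis
          using mat_path_1[of M k] bicrystal_iso_fst(1)[OF iso M eq] by (simp add: pl line_path_def)
      qed
      then have "M = diag_mat l"
        using off by (simp add: vec_eq_iff diag_mat_def)
      then have "q = line_path l" using diag[OF l] eq by auto
      then show "orbit_ge ?\<tau> ?\<nu>" by (simp add: pl)
    next
      assume "orbit_ge ?\<tau> ?\<nu>"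
      then have "?\<nu> = l" using Cbar_orbit_ge_eq[OF lC] by (simp add: pl)
      then have "q = line_path l" by (rule LS_init_dominant[OF lC q])
      then have "\<kappa> M = \<kappa> (diag_mat l)" using eq pl diag[OF l] by simp
      moreover have "inj_on \<kappa> Mats"
        using iso by (simp add: bicrystal_iso_def crystal_iso_def mat_crystal_def bij_betw_def)
      moreover have "diag_mat l \<in> Mats" using l by (simp add: Cbar_poly_def)
      ultimately have "M = diag_mat l" using M by (simp add: inj_on_eq_iff)
      then show "M \<in> Mats_low"
        using M by (auto simp: Mats_low_def diag_mat_def)
    qed
  next
    case False
    then obtain i where i: "i \<in> simple_index" and neg: "pair_h i (LS_init l p) < 0"
      by (auto simp: Cbar_def not_le)
    let ?M' = "mat_emax i M" and ?p' = "path_emax i p" and ?q' = "path_emax i q"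
    have M': "?M' \<in> Mats" and eq': "\<kappa> ?M' = (l, ?p', q)"
      using mat_emax_in_Mats[OF M] bicrystal_iso_fst(4)[OF iso M eq i] by auto
    have M'': "mat_emax_sharp i ?M' \<in> Mats" and eq'': "\<kappa> (mat_emax_sharp i ?M') = (l, ?p', ?q')"
      using M' mat_emax_in_Mats[of "transpose ?M'" i] bicrystal_iso_snd[OF iso M' eq' i] by auto
    \<comment> \<open>The converse direction takes the transposed operator first; both orders end at
      the same value of \<kappa>.\<close>
    let ?Ms = "mat_emax_sharp i M"
    have Ms: "?Ms \<in> Mats" and eqs: "\<kappa> ?Ms = (l, p, ?q')"
      using M mat_emax_in_Mats[of "transpose M" i] bicrystal_iso_snd[OF iso M eq i] by auto
    have eqs': "\<kappa> (mat_emax i ?Ms) = (l, ?p', ?q')"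
      using bicrystal_iso_fst(4)[OF iso Ms eqs i] .
    have p': "?p' \<in> LS_paths l" and q': "?q' \<in> LS_paths l"
      using bicrystal_iso_pairs[OF iso M'' eq''] by auto
    have rank: "orbit_rank l (LS_init l ?p') < orbit_rank l (LS_init l p)"
      using LS_init_path_emax[OF i p p'] neg orbit_rank_simple_refl[OF LS_init_in_orbit[OF p] i neg]
      by (simp add: lo_def)
    note IH = less.hyps[OF rank]
    have init_q': "LS_init l ?q' = lo i ?\<nu>" by (rule LS_init_path_emax[OF i q q'])
    have fin: "LS_final l ?p' = ?\<tau> \<or>
        LS_final l ?p' = simple_refl i ?\<tau> \<and> path_phi i p = 0 \<and> pair_h i ?\<tau> < 0"
      by (rule LS_final_path_emax[OF i p p'])
    have phi: "row_queue i M CARD('n) = path_phi i p"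
      by (rule bicrystal_iso_fst(3)[OF iso M eq i])
    have phi_nonneg: "0 \<le> path_phi i p"
      using row_queue_nonneg[OF M, of i "CARD('n)"] phi by simp
    show ?thesis
    proof
      assume low: "M \<in> Mats_low"
      show "orbit_ge ?\<tau> ?\<nu>"
      proof (cases "pair_h i ?\<tau> \<le> 0")
        case True
        have "mat_emax_sharp i ?M' \<in> Mats_low"
          using mat_emax_sharp_almost_low[OF i mat_emax_low[OF i low]] .
        then have "orbit_ge (LS_final l ?p') (lo i ?\<nu>)"
          using IH[OF M'' eq''] init_q' by simp
        then have "orbit_ge (hi i (LS_final l ?p')) (hi i ?\<nu>)"
          using hi_mono[OF i] hi_lo[OF i] by metis
        \<comment> \<open>Both alternatives in \<open>fin\<close> have the same \<open>hi\<close>,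
          and ?\<tau> is already the upper element of its pair.\<close>
        moreover have "hi i (LS_final l ?p') = ?\<tau>"
          using fin True hi_simple_refl[OF i, of ?\<tau>] by (auto simp: hi_def)
        ultimately show ?thesis
          using orbit_ge_trans hi_orbit_ge[OF i] by metis
      next
        case False
        then have "0 < row_queue i M CARD('n)"
          using path_phi_pos[OF p] phi by simp
        then have "?M' \<in> Mats_low" by (rule mat_emax_low_of_phi_pos[OF i low])
        then show ?thesis using IH[OF M' eq'] fin False by auto
      qed
    next
      assume ge: "orbit_ge ?\<tau> ?\<nu>"
      show "M \<in> Mats_low"
      proof (cases "path_phi i p = 0")
        case True
        \<comment> \<open>\<open>lo\<close> absorbs the possible reflection of the final
          direction.\<close>
        have "lo i ?\<tau> = lo i (LS_final l ?p')"
          using fin lo_simple_refl[OF i] by metis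
        then have "orbit_ge (LS_final l ?p') (lo i ?\<nu>)"
          using lo_mono[OF i ge] orbit_ge_lo[OF i] orbit_ge_trans by metis
        then have "mat_emax i ?Ms \<in> Mats_low"
          using IH[OF mat_emax_in_Mats[OF Ms] eqs'] init_q' by simp
        then have "?Ms \<in> Mats_low" by (rule mat_emax_lowD[OF i Ms])
        then show ?thesis
          using mat_emax_sharp_lowD[OF i M] phi True by simp
      next
        case False
        \<comment> \<open>Since phi_i is nonzero, \<open>fin\<close> leaves the final direction
          unchanged, and \<open>ge\<close> applies to \<open>?p'\<close> as it stands.\<close>
        then have "?M' \<in> Mats_low" using IH[OF M' eq'] fin ge by simp
        then show ?thesis by (rule mat_emax_lowD[OF i M])
      qed
    qed
  qed
qed

section \<open>Cosets of the stabilizer and the pieces of the target\<close>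

lemma Un_coset_piece:
  assumes "p \<in> LS_paths l" "q \<in> LS_paths l"
  shows "(p, q) \<in> (\<Union>c\<in>weyl_cosets l. coset_piece l c)
    \<longleftrightarrow> orbit_ge (LS_final l p) (LS_init l q)"
proof
  assume "orbit_ge (LS_final l p) (LS_init l q)"
  \<comment> \<open>The initial direction of \<open>q\<close> lies in the orbit, and any
    \<open>w\<close> producing it selects the coset.\<close>
  moreover obtain w where w: "w \<in> weyl" "LS_init l q = act w l"
    using LS_init_in_orbit[OF assms(2)] by (auto simp: orbit_of_def)
  moreover have "id \<in> stab l"
    by (simp add: stab_def weyl_def permutes_id act_def)
  then have "w \<in> (\<lambda>u. w \<circ> u) ` stab l" by (intro image_eqI[of _ _ id]) simp_all
  ultimately have "(p, q) \<in> coset_piece l ((\<lambda>u. w \<circ> u) ` stab l)"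
    unfolding coset_piece_def using assms by (intro UN_I[of w]) (simp_all add: B_upper_def B_hat_def)
  then show "(p, q) \<in> (\<Union>c\<in>weyl_cosets l. coset_piece l c)"
    using w(1) unfolding weyl_cosets_def by blast
qed (auto simp: coset_piece_def B_upper_def B_hat_def)

lemma act_comp:
  assumes "u \<in> weyl" "w \<in> weyl"
  shows "act (u \<circ> w) l = act u (act w l)"
  using assms by (simp add: weyl_def act_def o_inv_distrib permutes_bij)

lemma act_coset:
  assumes "w \<in> weyl" "v \<in> (\<lambda>u. w \<circ> u) ` stab l"
  shows "act v l = act w l"
  using assms by (auto simp: stab_def act_comp)

text \<open>The quotient of \<open>w\<close> by \<open>w'\<close> fixes \<open>l\<close>. One
  inclusion suffices, since the hypotheses are symmetric in \<open>w\<close> and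
  \<open>w'\<close>.\<close>

lemma coset_eq:
  assumes "w \<in> weyl" "w' \<in> weyl" "act w l = act w' l"
  shows "(\<lambda>u. w \<circ> u) ` stab l \<subseteq> (\<lambda>u. w' \<circ> u) ` stab l"
proof
  fix v assume "v \<in> (\<lambda>u. w \<circ> u) ` stab l"
  then obtain u where u: "u \<in> stab l" "v = w \<circ> u" by auto
  have inv: "inv w' \<in> weyl" using assms(2) by (simp add: weyl_def permutes_inv)
  have v: "v \<in> weyl"
    using assms(1) u by (simp add: stab_def weyl_def permutes_compose)
  have "act v l = act w' l"
    using u assms by (auto simp: act_comp stab_def)
  then have "act (inv w' \<circ> v) l = act (inv w') (act w' l)"
    by (simp add: act_comp[OF inv v])
  also have "\<dots> = act (inv w' \<circ> w') l"
    by (simp add: act_comp[OF inv assms(2)])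
  also have "\<dots> = l"
    using assms(2) by (simp add: weyl_def permutes_inv_o(2) act_def)
  finally have "inv w' \<circ> v \<in> stab l"
    using inv v by (simp add: stab_def weyl_def permutes_compose)
  moreover have "v = w' \<circ> (inv w' \<circ> v)"
    using assms(2) by (simp add: weyl_def o_assoc permutes_inv_o(1))
  ultimately show "v \<in> (\<lambda>u. w' \<circ> u) ` stab l" by blast
qed

lemma disjoint_coset_pieces: "disjoint_family_on (coset_piece l) (weyl_cosets l)"
  unfolding disjoint_family_on_def
proof (intro ballI impI equals0I)
  fix c c' x
  assume c: "c \<in> weyl_cosets l" "c' \<in> weyl_cosets l" "c \<noteq> c'"
    and x: "x \<in> coset_piece l c \<inter> coset_piece l c'"
  obtain w w' where w: "w \<in> weyl" "c = (\<lambda>u. w \<circ> u) ` stab l" "w' \<in> weyl" "c' = (\<lambda>u. w' \<circ> u) ` stab l"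
    using c(1,2) by (auto simp: weyl_cosets_def)
  \<comment> \<open>The second component alone separates the pieces: its initial direction
    determines the weight and hence the coset.\<close>
  have "LS_init l (snd x) = act w l" "LS_init l (snd x) = act w' l"
    using x act_coset[OF w(1), of _ l] act_coset[OF w(3), of _ l] unfolding w(2,4)
    by (auto simp: coset_piece_def B_hat_def)
  then have "act w l = act w' l" by simp
  then show False
    using coset_eq[of w w' l] coset_eq[of w' w l] w c(3) by auto
qed

theorem theorem4p6:
  fixes \<kappa> :: "'n::{finite,linorder} matrix \<Rightarrow> 'n target"
  assumes "2 \<le> CARD('n)"
    and "bicrystal_iso \<kappa>"
    and "\<And>l. l \<in> Cbar_poly \<Longrightarrow> \<kappa> (diag_mat l) = (l, line_path l, line_path l)"
  shows "bij_betw \<kappa> Mats_low (SIGMA l:Cbar_poly. \<Union>c\<in>weyl_cosets l. coset_piece l c) \<and>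
    (\<forall>l\<in>(Cbar_poly :: 'n weight set). disjoint_family_on (coset_piece l) (weyl_cosets l))"
proof
  define G where "G = (SIGMA l:(Cbar_poly :: 'n weight set). \<Union>c\<in>weyl_cosets l. coset_piece l c)"
  have bij: "bij_betw \<kappa> Mats pairs"
    using assms(2) by (simp add: bicrystal_iso_def crystal_iso_def mat_crystal_def pairs_crystal_fst_def)
  \<comment> \<open>As \<kappa> is already bijective onto \<open>pairs\<close>, it remains to see
    that \<open>G\<close> cuts out the images of the lower triangular matrices.\<close>
  have iff: "M \<in> Mats_low \<longleftrightarrow> \<kappa> M \<in> G" if "M \<in> Mats" for M
  proof -
    obtain l p q where eq: "\<kappa> M = (l, p, q)" by (metis prod_cases3)
    show ?thesis
      using bicrystal_iso_pairs[OF assms(2) that eq] low_iff_orbit_ge[OF assms(2,3) that eq]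
        Un_coset_piece[of p l q]
      by (auto simp: eq G_def)
  qed
  have "G \<subseteq> pairs"
    by (auto simp: G_def pairs_def coset_piece_def B_upper_def B_hat_def)
  have "\<kappa> ` Mats_low = G"
  proof (intro equalityI subsetI)
    fix x assume x: "x \<in> G"
    then obtain M where "M \<in> Mats" "x = \<kappa> M"
      using \<open>G \<subseteq> pairs\<close> bij_betw_imp_surj_on[OF bij] by blast
    then show "x \<in> \<kappa> ` Mats_low"
      using iff x by blast
  qed (use iff Mats_low_subset in blast)
  then show "bij_betw \<kappa> Mats_low (SIGMA l:Cbar_poly. \<Union>c\<in>weyl_cosets l. coset_piece l c)"
    using bij_betw_subset[OF bij, of Mats_low G] Mats_low_subset unfolding G_def by blast
  show "\<forall>l\<in>(Cbar_poly :: 'n weight set). disjoint_family_on (coset_piece l) (weyl_cosets l)"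
    by (simp add: disjoint_coset_pieces)
qed

end
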